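(* For every $d\ge 1$ and every $k,\ell\ge2$ there exists $n_0=n_0(d,k,\ell)$ such that the following holds. Let $C\subset\mathbb{R}^2$ be an irreducible real algebraic curve of degree at most $d$, and let $A\subset C(\mathbb{R})$ be finite with $|A|\ge n_0$. Then $A$ contains either $k$ collinear points or $\ell$ mutually visible points.
   Context: For $p,q\in\mathbb{R}^2$, $(pq)^\circ$ is the open segment joining them. Two points $p,q$ of a finite set $A\subset\mathbb{R}^2$ are visible in $A$ if $(pq)^\circ$ contains no point of $A$; a set of points of $A$ is mutually visible if every two of them are visible in $A$. *)

theory Defs
  imports "HOL-Analysis.Analysis" "HOL-Computational_Algebra.Computational_Algebra"
begin

text \<open>
  The ring of bivariate real polynomials is represented as \<open>real poly poly\<close>: the
  polynomial \<open>f\<close> stands for the sum of all \<open>a\<^sub>i(x) * y ^ i\<close> with \<open>a\<^sub>i = coeff f i\<close>.  Irreducibility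
  in \<open>\<real>[x,y]\<close> is then the library's \<^const>\<open>irreducible\<close>.
\<close>

definition poly2 :: "real poly poly \<Rightarrow> real \<Rightarrow> real \<Rightarrow> real" where
  "poly2 f x y = poly (poly f [:y:]) x"

lemma poly2_altdef:
  "poly2 f x y = (\<Sum>i\<le>degree f. poly (coeff f i) x * y ^ i)"
  unfolding poly2_def by (simp add: poly_altdef[of f] poly_sum poly_power)

text \<open>The inserted \<open>0\<close> only matters for the zero polynomial.\<close>

definition total_degree :: "real poly poly \<Rightarrow> nat" where
  "total_degree f = Max (insert 0 {i + degree (coeff f i) | i. coeff f i \<noteq> 0})"

lemma total_degree_le_iff:
  "total_degree f \<le> d \<longleftrightarrow> (\<forall>i j. coeff (coeff f i) j \<noteq> 0 \<longrightarrow> i + j \<le> d)"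
proof -
  have "{i + degree (coeff f i) | i. coeff f i \<noteq> 0} \<subseteq>
      (\<lambda>i. i + degree (coeff f i)) ` {..degree f}"
    using le_degree by auto
  then have fin: "finite {i + degree (coeff f i) | i. coeff f i \<noteq> 0}"
    by (rule finite_subset) simp
  have "total_degree f \<le> d \<longleftrightarrow> (\<forall>i. coeff f i \<noteq> 0 \<longrightarrow> i + degree (coeff f i) \<le> d)"
    unfolding total_degree_def using fin by (subst Max_le_iff) auto
  also have "\<dots> \<longleftrightarrow> (\<forall>i j. coeff (coeff f i) j \<noteq> 0 \<longrightarrow> i + j \<le> d)"
  proof (intro iffI allI impI)
    fix i j assume *: "\<forall>i. coeff f i \<noteq> 0 \<longrightarrow> i + degree (coeff f i) \<le> d"
      and nz: "coeff (coeff f i) j \<noteq> 0"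
    from nz have "coeff f i \<noteq> 0" by auto
    with * have "i + degree (coeff f i) \<le> d" by blast
    moreover have "j \<le> degree (coeff f i)" using nz by (rule le_degree)
    ultimately show "i + j \<le> d" by simp
  next
    fix i assume *: "\<forall>i j. coeff (coeff f i) j \<noteq> 0 \<longrightarrow> i + j \<le> d" and "coeff f i \<noteq> 0"
    then have "coeff (coeff f i) (degree (coeff f i)) \<noteq> 0" by simp
    with * show "i + degree (coeff f i) \<le> d" by blast
  qed
  finally show ?thesis .
qed

definition real_points :: "real poly poly \<Rightarrow> (real ^ 2) set" where
  "real_points f = {p. poly2 f (p $ 1) (p $ 2) = 0}"

definition visible_in :: "(real ^ 2) set \<Rightarrow> real ^ 2 \<Rightarrow> real ^ 2 \<Rightarrow> bool" where
  "visible_in A p q \<longleftrightarrow> open_segment p q \<inter> A = {}"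

definition mutually_visible :: "(real ^ 2) set \<Rightarrow> (real ^ 2) set \<Rightarrow> bool" where
  "mutually_visible A S \<longleftrightarrow> S \<subseteq> A \<and> pairwise (visible_in A) S"

end

theory Submission
  imports Defs "HOL-Computational_Algebra.Field_as_Ring" "Subresultants.Subresultant_Gcd"
begin

text \<open>
  If the curve is not a line, elimination bounds the number of vertical tangents, vertical
  asymptotes and inflection points in terms of \<open>d\<close>, so the curve splits into boundedly many strictly
  convex or concave graphs over intervals.  By pigeonhole one of these arcs contains
  \<open>N \<ge> \<bar>A\<bar> / M\<close> points \<open>q\<^sub>0, \<dots>, q\<^sub>N\<^sub>-\<^sub>1\<close> of \<open>A\<close>, up to a bounded error, with \<open>M\<close> depending only on \<open>d\<close>.

  Give the chord \<open>q\<^sub>i q\<^sub>j\<close> the weight \<open>1 / (j - i)\<close>.  The chords through a fixed point of \<open>A\<close> pairwise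
  cross, hence have total weight at most \<open>1\<close>, so the blocked chords have total weight at most
  \<open>\<bar>A\<bar> \<le> 2 M N\<close>.  If no \<open>l\<close> points were mutually visible, each progression
  \<open>q\<^sub>i, q\<^sub>i\<^sub>+\<^sub>s, \<dots>, q\<^sub>i\<^sub>+\<^sub>(\<^sub>l\<^sub>-\<^sub>1\<^sub>)\<^sub>s\<close> would contain a blocked chord, and summing over \<open>i\<close> and \<open>s\<close> the blocked
  weight would be at least a constant times \<open>N ln N / l\<^sup>3\<close>, which is impossible for large \<open>N\<close>.
\<close>

no_notation vec_index (infixl \<open>$\<close> 100)
no_notation fps_nth (infixl \<open>$\<close> 75)

section \<open>Weights of chords of a convex chain\<close>

text \<open>Twice the signed area of the triangle \<open>a b c\<close>. A chain is convex or concave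
  according to the common sign of its triples, so a single factor \<open>\<sigma>\<close> treats
  both cases at once.\<close>

definition orient :: "real ^ 2 \<Rightarrow> real ^ 2 \<Rightarrow> real ^ 2 \<Rightarrow> real" where
  "orient a b c = (b $ 1 - a $ 1) * (c $ 2 - a $ 2) - (b $ 2 - a $ 2) * (c $ 1 - a $ 1)"

lemma orient_convex_combination:
  "orient a ((1 - u) *\<^sub>R b + u *\<^sub>R b') c = (1 - u) * orient a b c + u * orient a b' c"
  by (simp add: orient_def algebra_simps)

lemma orient_degenerate [simp]: "orient a a c = 0" "orient a c c = 0"
  by (simp_all add: orient_def)

text \<open>Fix a pair \<open>(i, j)\<close> and split \<open>E\<close> at its left index. Pairs
  starting after \<open>i\<close> are determined by their start, which lies strictly between
  \<open>i\<close> and \<open>m\<close>. The other pairs end no later than \<open>j\<close> by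
  monotonicity and are determined by their end in \<open>{m..j}\<close>. The two ranges have
  \<open>m - i - 1\<close> and \<open>j - m + 1\<close> elements, together
  \<open>j - i\<close>.\<close>

lemma card_le_length_of_crossing:
  fixes E :: "(nat \<times> nat) set"
  assumes "finite E" "(i, j) \<in> E"
    and sep: "\<And>i j. (i, j) \<in> E \<Longrightarrow> i < m \<and> m \<le> j"
    and less: "\<And>i j i' j'. (i, j) \<in> E \<Longrightarrow> (i', j') \<in> E \<Longrightarrow> i < i' \<Longrightarrow> j < j'"
    and eq: "\<And>i j j'. (i, j) \<in> E \<Longrightarrow> (i, j') \<in> E \<Longrightarrow> j = j'"
  shows "card E \<le> j - i"
proof -
  define E1 where "E1 = {e \<in> E. i < fst e}"
  define E2 where "E2 = {e \<in> E. fst e \<le> i}"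
  have E: "E = E1 \<union> E2" by (auto simp: E1_def E2_def)
  have "card E1 \<le> card {i<..<m}"
  proof (rule card_inj_on_le)
    show "inj_on fst E1" using eq by (auto simp: inj_on_def E1_def)
    show "fst ` E1 \<subseteq> {i<..<m}" using sep by (auto simp: E1_def)
  qed simp
  moreover have "card E2 \<le> card {m..j}"
  proof (rule card_inj_on_le)
    have "a = c" if "(a, b) \<in> E" "(c, b) \<in> E" for a b c
      using less[OF that] less[OF that(2,1)] by (metis less_irrefl linorder_neqE_nat)
    then show "inj_on snd E2" by (auto simp: inj_on_def E2_def)
    have "j' \<le> j" if "(i', j') \<in> E" "i' \<le> i" for i' j'
      using less[OF that(1) assms(2)] eq[OF assms(2)] that by (cases "i' = i") fastforce+
    then show "snd ` E2 \<subseteq> {m..j}" using sep by (auto simp: E2_def)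
  qed simp
  moreover have "card E \<le> card E1 + card E2" unfolding E by (rule card_Un_le)
  moreover have "i < m" "m \<le> j" using sep[OF assms(2)] by auto
  ultimately show ?thesis by (simp; linarith)
qed

text \<open>Chords \<open>(i, j)\<close> and \<open>(i', j')\<close> of a convex chain through a common point cross, so
  the shortest of the chords through that point is at least as long as their number.\<close>

lemma sum_inverse_length_through_point_le_1:
  fixes q :: "nat \<Rightarrow> real ^ 2" and \<sigma> :: real
  assumes mono: "\<And>i j. i < j \<Longrightarrow> j < N \<Longrightarrow> q i $ 1 < q j $ 1"
    and conv: "\<And>i j k. i < j \<Longrightarrow> j < k \<Longrightarrow> k < N \<Longrightarrow> \<sigma> * orient (q i) (q j) (q k) > 0"
  shows "(\<Sum>(i, j) \<in> {(i, j). i < j \<and> j < N \<and> b \<in> open_segment (q i) (q j)}. 1 / real (j - i)) \<le> 1"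
proof -
  define E where "E = {(i, j). i < j \<and> j < N \<and> b \<in> open_segment (q i) (q j)}"
  have "finite E" by (rule finite_subset[of _ "{..<N} \<times> {..<N}"]) (auto simp: E_def)
  have seg: "\<exists>u. 0 < u \<and> u < 1 \<and> b = (1 - u) *\<^sub>R q i + u *\<^sub>R q j" if "(i, j) \<in> E" for i j
    using that by (auto simp: E_def in_segment)
  have between: "q i $ 1 < b $ 1 \<and> b $ 1 < q j $ 1" if ij: "(i, j) \<in> E" for i j
  proof -
    obtain u where u: "0 < u" "u < 1" "b = (1 - u) *\<^sub>R q i + u *\<^sub>R q j" using seg[OF ij] by blast
    have "q i $ 1 < q j $ 1" using ij mono by (auto simp: E_def)
    then have "0 < u * (q j $ 1 - q i $ 1)" "0 < (1 - u) * (q j $ 1 - q i $ 1)" using u by simp_all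
    then show ?thesis unfolding u(3) by (simp add: algebra_simps)
  qed
  \<comment> \<open>The chain points to the left of \<open>b\<close> are those with index below
    \<open>m\<close>, so every chord through \<open>b\<close> starts before \<open>m\<close> and
    ends at \<open>m\<close> or later.\<close>
  define m where "m = card {i. i < N \<and> q i $ 1 < b $ 1}"
  have less_iff: "q i $ 1 < q j $ 1 \<longleftrightarrow> i < j" if "i < N" "j < N" for i j
    using mono that by (metis less_asym' linorder_neqE_nat order_less_irrefl)
  have sep: "i < m \<and> m \<le> j" if "(i, j) \<in> E" for i j
  proof
    have ij: "i < j" "j < N" using that by (auto simp: E_def)
    have "k < N \<and> q k $ 1 < b $ 1" if "k \<le> i" for k
      using less_iff[of k i] that ij between[OF \<open>(i, j) \<in> E\<close>] by (cases "k = i") auto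
    then have "{..i} \<subseteq> {k. k < N \<and> q k $ 1 < b $ 1}" by auto
    from card_mono[OF _ this] show "i < m" by (simp add: m_def)
    have "k < j" if "k < N \<and> q k $ 1 < b $ 1" for k
      using less_iff[of k j] that ij between[OF \<open>(i, j) \<in> E\<close>] by auto
    then have "{k. k < N \<and> q k $ 1 < b $ 1} \<subseteq> {..<j}" by auto
    from card_mono[OF _ this] show "m \<le> j" by (simp add: m_def)
  qed
  have orient0: "orient (q i) b (q j) = 0" if "(i, j) \<in> E" for i j
    using seg[OF that] by (auto simp: orient_convex_combination)
  \<comment> \<open>If the second chord were nested under the first, \<open>q i'\<close> would lie
    strictly, and \<open>q j'\<close> weakly, on one side of the line through \<open>q i\<close> and
    \<open>q j\<close>. Their proper convex combination \<open>b\<close> would then lie strictly on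
    that side, although it is on the line.\<close>
  have less: "j < j'" if E: "(i, j) \<in> E" "(i', j') \<in> E" and "i < i'" for i j i' j'
  proof (rule ccontr)
    assume "\<not> j < j'"
    obtain u where u: "0 < u" "u < 1" "b = (1 - u) *\<^sub>R q i' + u *\<^sub>R q j'" using seg[OF E(2)] by blast
    have ord: "i < i'" "i' < j'" "j' \<le> j" "j < N" using E \<open>i < i'\<close> \<open>\<not> j < j'\<close> by (auto simp: E_def)
    have "0 < \<sigma> * orient (q i) (q i') (q j)" using ord by (intro conv) auto
    moreover have "0 \<le> \<sigma> * orient (q i) (q j') (q j)"
      using conv[of i j' j] ord by (cases "j' = j") auto
    ultimately have "0 < (1 - u) * (\<sigma> * orient (q i) (q i') (q j)) + u * (\<sigma> * orient (q i) (q j') (q j))"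
      using u by (intro add_pos_nonneg) auto
    also have "\<dots> = \<sigma> * orient (q i) b (q j)"
      unfolding u(3) orient_convex_combination by (simp add: algebra_simps)
    finally show False using orient0[OF E(1)] by simp
  qed
  \<comment> \<open>Two chords with the same left end point have different directions, so they meet
    only in that end point, which the open segments exclude.\<close>
  have not_less: "\<not> j < j'" if E: "(i, j) \<in> E" "(i, j') \<in> E" for i j j'
  proof
    assume "j < j'"
    obtain u where u: "0 < u" "u < 1" "b = (1 - u) *\<^sub>R q i + u *\<^sub>R q j" using seg[OF E(1)] by blast
    have "0 < \<sigma> * orient (q i) (q j) (q j')" using E \<open>j < j'\<close> by (intro conv) (auto simp: E_def)
    then have "orient (q i) b (q j') \<noteq> 0" unfolding u(3) orient_convex_combination using u by auto
    then show False using orient0[OF E(2)] by simp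
  qed
  have eq: "j = j'" if "(i, j) \<in> E" "(i, j') \<in> E" for i j j'
    using not_less[OF that] not_less[OF that(2,1)] by linarith
  \<comment> \<open>Every chord is at least as long as the number of chords, so each of the
    \<open>card E\<close> terms is at most \<open>1 / card E\<close>.\<close>
  have "(\<Sum>(i, j)\<in>E. 1 / real (j - i)) \<le> (\<Sum>e\<in>E. 1 / real (card E))"
  proof (rule sum_mono, clarify)
    fix i j assume ij: "(i, j) \<in> E"
    have "card E \<le> j - i"
      by (rule card_le_length_of_crossing[OF \<open>finite E\<close> ij sep less eq])
    moreover have "card E > 0" using ij \<open>finite E\<close> card_gt_0_iff by blast
    ultimately show "1 / real (j - i) \<le> 1 / real (card E)" by (intro divide_left_mono) auto
  qed
  also have "\<dots> \<le> 1" by simp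
  finally show ?thesis by (simp add: E_def)
qed

text \<open>Union bound: a blocked chord passes through some \<open>b\<close> in \<open>A\<close>,
  and the chords through one \<open>b\<close> weigh at most 1. Chords with several blockers are
  merely counted repeatedly on the larger side.\<close>

lemma sum_inverse_length_blocked_le:
  fixes q :: "nat \<Rightarrow> real ^ 2" and \<sigma> :: real
  assumes mono: "\<And>i j. i < j \<Longrightarrow> j < N \<Longrightarrow> q i $ 1 < q j $ 1"
    and conv: "\<And>i j k. i < j \<Longrightarrow> j < k \<Longrightarrow> k < N \<Longrightarrow> \<sigma> * orient (q i) (q j) (q k) > 0"
    and "finite A"
  shows "(\<Sum>(i, j) \<in> {(i, j). i < j \<and> j < N \<and> \<not> visible_in A (q i) (q j)}. 1 / real (j - i))
    \<le> real (card A)"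
proof -
  define E where "E b = {(i, j). i < j \<and> j < N \<and> b \<in> open_segment (q i) (q j)}" for b
  define w where "w = (\<lambda>(i, j). 1 / real (j - i))"
  have fin: "finite (E b)" for b
    by (rule finite_subset[of _ "{..<N} \<times> {..<N}"]) (auto simp: E_def)
  have "{(i, j). i < j \<and> j < N \<and> \<not> visible_in A (q i) (q j)} = snd ` Sigma A E"
    unfolding snd_image_Sigma by (auto simp: E_def visible_in_def)
  then have "sum w {(i, j). i < j \<and> j < N \<and> \<not> visible_in A (q i) (q j)} = sum w (snd ` Sigma A E)"
    by (rule arg_cong)
  also have "\<dots> \<le> sum (w \<circ> snd) (Sigma A E)"
    using fin \<open>finite A\<close> by (intro sum_image_le) (auto simp: w_def)
  also have "\<dots> = (\<Sum>b\<in>A. sum w (E b))"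
    using fin \<open>finite A\<close> by (subst sum.Sigma) (auto simp: o_def split_beta)
  also have "\<dots> \<le> (\<Sum>b\<in>A. 1)"
    unfolding w_def E_def by (intro sum_mono sum_inverse_length_through_point_le_1[OF mono conv])
  finally show ?thesis by (simp add: w_def)
qed

text \<open>Each length occurs in boundedly many of the progressions considered here, while the number
  of progressions is of order \<open>N\<close> for each difference \<open>s\<close>; this gives the harmonic sum.\<close>

lemma harm_le_sum_inverse_length:
  fixes B :: "(nat \<times> nat) set"
  assumes "l > 0" "finite B"
    and AP: "\<And>i s. s > 0 \<Longrightarrow> i + (l - 1) * s < N \<Longrightarrow>
      \<exists>a a'. a < a' \<and> a' < l \<and> (i + a * s, i + a' * s) \<in> B"
  shows "real N * harm (N div (2 * l)) \<le> 2 * real l ^ 3 * (\<Sum>(i, j)\<in>B. 1 / real (j - i))"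
proof -
  define S where "S = N div (2 * l)"
  define w where "w = (\<lambda>(i, j). 1 / real (j - i))"
  \<comment> \<open>Starts and differences of progressions that stay below \<open>N\<close>. Since
    \<open>l * S\<close> is at most \<open>N / 2\<close>, at least half of the starts remain
    available for each difference.\<close>
  define I where "I = {..<N - l * S} \<times> {1..S}"
  define P where "P = {(a, a'). a < a' \<and> a' < l}"
  \<comment> \<open>The chord between terms number \<open>a\<close> and \<open>a'\<close> of the
    progression with start \<open>i\<close> and difference \<open>s\<close>.\<close>
  define h where "h = (\<lambda>(a::nat, a'::nat) (i::nat, s::nat). (i + a * s, i + a' * s))"
  have finP: "finite P" by (rule finite_subset[of _ "{..<l} \<times> {..<l}"]) (auto simp: P_def)
  have "P \<subseteq> {..<l} \<times> {..<l}" by (auto simp: P_def)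
  from card_mono[OF _ this] have cardP: "card P \<le> l * l" by simp
  have w0: "w e \<ge> 0" for e by (simp add: w_def split_beta)
  have lS: "2 * (l * S) \<le> N" unfolding S_def by (metis mult.assoc times_div_less_eq_dividend)
  have "real (2 * (l * S)) \<le> real N" using lS by (rule of_nat_mono)
  moreover have "real (N - l * S) = real N - real (l * S)" using lS by (intro of_nat_diff) linarith
  ultimately have "real N / 2 * harm S \<le> real (N - l * S) * harm S"
    by (intro mult_right_mono) (simp_all add: harm_nonneg)
  then have "real N / (2 * real l) * harm S \<le> real (N - l * S) * harm S / real l"
    using \<open>l > 0\<close> by (simp add: field_simps)
  also have "\<dots> = (\<Sum>(i, s)\<in>I. 1 / (real l * real s))"
    unfolding I_def harm_def
    by (simp add: sum.cartesian_product[symmetric] sum_distrib_left sum_divide_distrib field_simps)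
  also have "\<dots> \<le> (\<Sum>e\<in>I. \<Sum>p\<in>P. if h p e \<in> B then w (h p e) else 0)"
  \<comment> \<open>The chord of \<open>B\<close> inside the progression has length
    \<open>(a' - a) * s\<close>, at most \<open>l * s\<close>, so it alone pays for the term
    \<open>1 / (l * s)\<close>.\<close>
  proof (rule sum_mono, clarify)
    fix i s assume iS: "(i, s) \<in> I"
    then have "s > 0" "s \<le> S" "i < N - l * S" by (auto simp: I_def)
    have "(l - 1) * s \<le> l * S" using \<open>s \<le> S\<close> by (intro mult_mono) auto
    then have "i + (l - 1) * s < N" using \<open>i < N - l * S\<close> by linarith
    from AP[OF \<open>s > 0\<close> this] obtain a a' where
      a: "a < a'" "a' < l" "(i + a * s, i + a' * s) \<in> B" by blast
    have "(i + a' * s) - (i + a * s) = (a' - a) * s" by (simp add: diff_mult_distrib)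
    moreover have "(a' - a) * s \<le> l * s" using a by (intro mult_right_mono) auto
    then have "real ((a' - a) * s) \<le> real l * real s" by (metis of_nat_le_iff of_nat_mult)
    moreover have "(a' - a) * s > 0" using a \<open>s > 0\<close> by simp
    ultimately have "1 / (real l * real s) \<le> w (h (a, a') (i, s))"
      by (simp only: w_def h_def prod.case) (intro divide_left_mono, auto intro!: mult_pos_pos)
    also have "\<dots> = (if h (a, a') (i, s) \<in> B then w (h (a, a') (i, s)) else 0)"
      using a by (simp add: h_def)
    also have "\<dots> \<le> (\<Sum>p\<in>P. if h p (i, s) \<in> B then w (h p (i, s)) else 0)"
      using a finP w0 by (intro member_le_sum) (auto simp: P_def)
    finally show "1 / (real l * real s) \<le> (\<Sum>p\<in>P. if h p (i, s) \<in> B then w (h p (i, s)) else 0)" .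
  qed
  also have "\<dots> = (\<Sum>p\<in>P. \<Sum>e\<in>I. if h p e \<in> B then w (h p e) else 0)"
    by (rule sum.swap)
  also have "\<dots> \<le> (\<Sum>p\<in>P. sum w B)"
  proof (rule sum_mono)
    fix p assume "p \<in> P"
    then obtain a a' where p: "p = (a, a')" "a < a'" by (auto simp: P_def)
    \<comment> \<open>For fixed positions \<open>a < a'\<close> the two ends of a chord determine
      the progression. Hence each position pair counts \<open>B\<close> at most once, and there are
      at most \<open>l * l\<close> position pairs.\<close>
    have inj: "inj (h p)"
    proof (rule injI, clarify)
      fix i s i' s' assume "h p (i, s) = h p (i', s')"
      then have *: "i + a * s = i' + a * s'" "i + a' * s = i' + a' * s'" by (auto simp: p h_def)
      obtain c where c: "a' = a + c" "c > 0" using p(2) by (metis less_imp_add_positive)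
      have "c * s = c * s'" using * unfolding c(1) add_mult_distrib by linarith
      then show "i = i' \<and> s = s'" using c * by simp
    qed
    have "(\<Sum>e\<in>I. if h p e \<in> B then w (h p e) else 0) = (\<Sum>e\<in>{e\<in>I. h p e \<in> B}. w (h p e))"
      by (rule sum.inter_filter[symmetric]) (simp add: I_def)
    also have "\<dots> = sum w (h p ` {e\<in>I. h p e \<in> B})"
      using inj by (subst sum.reindex) (auto intro: inj_on_subset)
    also have "\<dots> \<le> sum w B" using w0 \<open>finite B\<close> by (intro sum_mono2) auto
    finally show "(\<Sum>e\<in>I. if h p e \<in> B then w (h p e) else 0) \<le> sum w B" .
  qed
  also have "\<dots> \<le> real (l * l) * sum w B"
    unfolding sum_constant by (intro mult_right_mono sum_nonneg of_nat_mono cardP w0)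
  finally show ?thesis using \<open>l > 0\<close> unfolding S_def[symmetric] w_def[symmetric]
    by (simp add: field_simps power3_eq_cube)
qed

text \<open>The failure of the conclusion supplies the hypothesis \<open>AP\<close> of the harmonic
  lower bound for the blocked chords; \<open>large\<close> says that this bound exceeds the upper
  bound \<open>card A\<close>.\<close>

lemma convex_chain_visible:
  fixes q :: "nat \<Rightarrow> real ^ 2" and \<sigma> :: real
  assumes mono: "\<And>i j. i < j \<Longrightarrow> j < N \<Longrightarrow> q i $ 1 < q j $ 1"
    and conv: "\<And>i j k. i < j \<Longrightarrow> j < k \<Longrightarrow> k < N \<Longrightarrow> \<sigma> * orient (q i) (q j) (q k) > 0"
    and "finite A" "l > 0" and sub: "\<And>i. i < N \<Longrightarrow> q i \<in> A"
    and large: "2 * real l ^ 3 * real (card A) < real N * harm (N div (2 * l))"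
  shows "\<exists>S\<subseteq>A. card S = l \<and> mutually_visible A S"
proof (rule ccontr)
  assume no: "\<not> ?thesis"
  define B where "B = {(i, j). i < j \<and> j < N \<and> \<not> visible_in A (q i) (q j)}"
  have "finite B" by (rule finite_subset[of _ "{..<N} \<times> {..<N}"]) (auto simp: B_def)
  have "\<exists>a a'. a < a' \<and> a' < l \<and> (i + a * s, i + a' * s) \<in> B"
    if s: "s > 0" and N: "i + (l - 1) * s < N" for i s
  proof -
    define T where "T = (\<lambda>a. q (i + a * s)) ` {..<l}"
    have bound: "i + a * s < N" if "a < l" for a
    proof -
      have "a * s \<le> (l - 1) * s" using that by (intro mult_right_mono) auto
      then show ?thesis using N by linarith
    qed
    have ne: "q (i + a * s) \<noteq> q (i + a' * s)" if "a < a'" "a' < l" for a a'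
      using mono[of "i + a * s" "i + a' * s"] bound[of a'] that s by auto
    have "inj_on (\<lambda>a. q (i + a * s)) {..<l}"
      by (rule linorder_inj_onI) (use ne in auto)
    then have "card T = l" by (simp add: T_def card_image)
    moreover have "T \<subseteq> A" using bound sub by (auto simp: T_def)
    ultimately have "\<not> pairwise (visible_in A) T" using no by (auto simp: mutually_visible_def)
    then obtain a a' where a: "a < l" "a' < l" "q (i + a * s) \<noteq> q (i + a' * s)"
      "\<not> visible_in A (q (i + a * s)) (q (i + a' * s))"
      by (auto simp: pairwise_def T_def)
    have "\<not> visible_in A (q (i + a' * s)) (q (i + a * s))"
      using a(4) by (simp add: visible_in_def open_segment_commute)
    moreover have "a \<noteq> a'" using a(3) by auto
    \<comment> \<open>\<open>pairwise\<close> yields the two positions in either order, whereas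
      \<open>B\<close> lists only increasing index pairs.\<close>
    ultimately have "(i + min a a' * s, i + max a a' * s) \<in> B" "min a a' < max a a'" "max a a' < l"
      using a bound s by (auto simp: B_def min_def max_def)
    then show ?thesis by blast
  qed
  from harm_le_sum_inverse_length[OF \<open>l > 0\<close> \<open>finite B\<close> this]
  have "real N * harm (N div (2 * l)) \<le> 2 * real l ^ 3 * (\<Sum>(i, j)\<in>B. 1 / real (j - i))" .
  also have "\<dots> \<le> 2 * real l ^ 3 * real (card A)"
    unfolding B_def by (intro mult_left_mono sum_inverse_length_blocked_le[OF mono conv \<open>finite A\<close>]) auto
  finally show False using large by simp
qed

section \<open>Elimination\<close>

text \<open>Restriction to a vertical line. Written as a coefficientwise ring homomorphism, it
  commutes with resultants as long as the leading coefficients survive.\<close>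

definition spec :: "real poly poly \<Rightarrow> real \<Rightarrow> real poly" where
  "spec f x = map_poly (\<lambda>c. poly c x) f"

lemma poly_spec: "poly (spec f x) y = poly2 f x y"
  unfolding spec_def poly2_def by (induction f) (auto simp: map_poly_pCons)

lemma degree_spec: "poly (lead_coeff f) x \<noteq> 0 \<Longrightarrow> degree (spec f x) = degree f"
  unfolding spec_def
  by (intro antisym map_poly_degree_leq) (auto intro: le_degree simp: Polynomial.coeff_map_poly)

lemma comm_ring_hom_poly_eval: "comm_ring_hom (\<lambda>p::real poly. poly p x)"
  by unfold_locales auto

text \<open>Bounds the degrees in the two variables separately. Such bounds add under products,
  survive both partial derivatives, and control both the size and the entries of a Sylvester
  matrix.\<close>

definition coeffs_bounded :: "nat \<Rightarrow> real poly poly \<Rightarrow> bool" where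
  "coeffs_bounded D f \<longleftrightarrow> degree f \<le> D \<and> (\<forall>i. degree (coeff f i) \<le> D)"

lemma degree_det_le:
  fixes M :: "'a::comm_ring_1 poly mat"
  assumes "M \<in> carrier_mat n n" "\<And>i j. i < n \<Longrightarrow> j < n \<Longrightarrow> degree (M $$ (i,j)) \<le> D"
  shows "degree (Determinant.det M) \<le> n * D"
proof -
  have "degree (signof \<pi> * (\<Prod>i<n. M $$ (i, \<pi> i))) \<le> n * D" if "\<pi> permutes {..<n}" for \<pi>
  proof -
    have "degree (signof \<pi> * (\<Prod>i<n. M $$ (i, \<pi> i))) \<le> degree (\<Prod>i<n. M $$ (i, \<pi> i))"
      by (auto simp: sign_def)
    also have "\<dots> \<le> (\<Sum>i<n. degree (M $$ (i, \<pi> i)))"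
      by (rule degree_prod_sum_le[unfolded o_def]) simp
    also have "\<dots> \<le> (\<Sum>i<n. D)"
      using assms(2) permutes_in_image[OF that] by (intro sum_mono) auto
    finally show ?thesis by simp
  qed
  then show ?thesis
    using assms(1) by (auto simp: det_def atLeast0LessThan intro!: degree_sum_le finite_permutations)
qed

text \<open>The resultant with respect to \<open>y\<close> is nonzero, because a common factor of
  positive degree would be associated to the irreducible \<open>f\<close>. It vanishes below each
  common zero at which neither leading coefficient vanishes; multiplying by both leading
  coefficients covers the remaining abscissae and adds \<open>D + E\<close> to the degree.\<close>

lemma elimination:
  assumes "irreducible f" "degree f > 0" "\<not> f dvd g"
    and "coeffs_bounded D f" "coeffs_bounded E g"
  shows "\<exists>r. r \<noteq> 0 \<and> degree r \<le> D + E + (D + E) * max D E \<and>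
    (\<forall>x y. poly2 f x y = 0 \<longrightarrow> poly2 g x y = 0 \<longrightarrow> poly r x = 0)"
proof -
  define R where "R = resultant f g"
  have "g \<noteq> 0" "f \<noteq> 0" using assms by auto
  have "R \<noteq> 0"
  proof
    assume "R = 0"
    then have "degree (gcd f g) \<noteq> 0" by (simp add: R_def resultant_0_gcd)
    then have "\<not> gcd f g dvd 1" by (simp add: poly_dvd_1)
    with assms(1) have "f dvd gcd f g"
      using irreducibleD' gcd_dvd1 by blast
    then have "f dvd g" using dvd_trans by blast
    with assms(3) show False by simp
  qed
  moreover have "degree R \<le> (degree f + degree g) * max D E"
    unfolding R_def resultant_def
    using assms(4,5) 
    by (intro degree_det_le) (auto simp: coeffs_bounded_def sylvester_index_mat le_max_iff_disj)
  moreover have "(degree f + degree g) * max D E \<le> (D + E) * max D E"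
    using assms(4,5) by (intro mult_right_mono) (auto simp: coeffs_bounded_def)
  moreover have "poly R x = 0" if "poly2 f x y = 0" "poly2 g x y = 0"
    "poly (lead_coeff f) x \<noteq> 0" "poly (lead_coeff g) x \<noteq> 0" for x y
  proof -
    have "resultant (spec f x) (spec g x) = poly R x"
      unfolding R_def spec_def
      by (rule comm_ring_hom.resultant_map_poly[OF comm_ring_hom_poly_eval])
         (use that degree_spec in \<open>auto simp: spec_def\<close>)
    moreover have "degree (gcd (spec f x) (spec g x)) \<noteq> 0"
    \<comment> \<open>The common root \<open>y\<close> gives both specializations the linear factor
      with root \<open>y\<close>.\<close>
    proof -
      have "[:-y, 1:] dvd spec f x" "[:-y, 1:] dvd spec g x"
        using that(1,2) unfolding poly_eq_0_iff_dvd[symmetric] poly_spec .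
      then have "[:-y, 1:] dvd gcd (spec f x) (spec g x)"
        by (rule gcd_greatest)
      moreover have "coeff (spec f x) (degree f) \<noteq> 0"
        using that(3) by (simp add: spec_def Polynomial.coeff_map_poly)
      then have "gcd (spec f x) (spec g x) \<noteq> 0" by auto
      ultimately have "degree [:-y, 1:] \<le> degree (gcd (spec f x) (spec g x))"
        by (rule dvd_imp_degree_le)
      then show ?thesis by simp
    qed
    ultimately show ?thesis using resultant_0_gcd[of "spec f x" "spec g x"] by simp
  qed
  moreover have "degree (lead_coeff f * lead_coeff g * R) \<le> 
      degree (lead_coeff f) + degree (lead_coeff g) + degree R"
    by (meson add_mono_thms_linordered_semiring(3) degree_mult_le order_trans)
  moreover have "degree (lead_coeff f) \<le> D" "degree (lead_coeff g) \<le> E"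
    using assms(4,5) by (auto simp: coeffs_bounded_def)
  ultimately have "degree (lead_coeff f * lead_coeff g * R) \<le> D + E + (D + E) * max D E"
    and "lead_coeff f * lead_coeff g * R \<noteq> 0"
    and "poly2 f x y = 0 \<Longrightarrow> poly2 g x y = 0 \<Longrightarrow> poly (lead_coeff f * lead_coeff g * R) x = 0" for x y
    using \<open>f \<noteq> 0\<close> \<open>g \<noteq> 0\<close> by - (linarith, auto)
  then show ?thesis by blast
qed

section \<open>Real roots as functions of the abscissa\<close>

lemma poly2_simps [simp]:
  "poly2 0 x y = 0"
  "poly2 1 x y = 1"
  "poly2 (pCons a f) x y = poly a x + y * poly2 f x y"
  "poly2 (f + g) x y = poly2 f x y + poly2 g x y"
  "poly2 (f - g) x y = poly2 f x y - poly2 g x y"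
  "poly2 (- f) x y = - poly2 f x y"
  "poly2 (f * g) x y = poly2 f x y * poly2 g x y"
  by (simp_all add: poly2_def)

lemma tendsto_poly2 [tendsto_intros]:
  "(u \<longlongrightarrow> a) F \<Longrightarrow> (v \<longlongrightarrow> b) F \<Longrightarrow> ((\<lambda>t. poly2 f (u t) (v t)) \<longlongrightarrow> poly2 f a b) F"
  by (induction f) (auto intro!: tendsto_intros)

lemma continuous_on_poly2 [continuous_intros]:
  "continuous_on S u \<Longrightarrow> continuous_on S v \<Longrightarrow> continuous_on S (\<lambda>t. poly2 f (u t) (v t))"
  unfolding continuous_on_def by (auto intro: tendsto_poly2)

abbreviation pderiv_x :: "real poly poly \<Rightarrow> real poly poly" where
  "pderiv_x f \<equiv> map_poly pderiv f"

lemma DERIV_poly2: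
  assumes "(u has_real_derivative u') (at t)" "(v has_real_derivative v') (at t)"
  shows "((\<lambda>t. poly2 f (u t) (v t)) has_real_derivative
    poly2 (pderiv_x f) (u t) (v t) * u' + poly2 (pderiv f) (u t) (v t) * v') (at t)"
proof (induction f)
  case (pCons a f)
  have "((\<lambda>t. poly a (u t)) has_real_derivative poly (pderiv a) (u t) * u') (at t)"
    by (rule DERIV_chain2[OF poly_DERIV assms(1)])
  from DERIV_add[OF this DERIV_mult[OF assms(2) pCons.IH]] show ?case
    by (simp add: Polynomial.map_poly_pCons pderiv_pCons algebra_simps)
qed simp

lemma DERIV_poly2_snd: "((\<lambda>y. poly2 f x y) has_real_derivative poly2 (pderiv f) x y) (at y)"
  using DERIV_poly2[of "\<lambda>_. x" 0 y "\<lambda>y. y" 1 f] by simp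

definition roots :: "real poly poly \<Rightarrow> real \<Rightarrow> real set" where
  "roots f x = {y. poly2 f x y = 0}"

text \<open>The branches of the curve, counted from 0 upwards from the lowest. The value is
  meaningful only if the roots over \<open>x\<close> are finite in number and more than
  \<open>k\<close>.\<close>

definition nth_root :: "real poly poly \<Rightarrow> nat \<Rightarrow> real \<Rightarrow> real" where
  "nth_root f k x = sorted_list_of_set (roots f x) ! k"

text \<open>The first condition keeps roots from escaping to infinity near \<open>x\<close>; the
  second makes every real root simple, excluding vertical tangents and singular points.\<close>

definition regular_at :: "real poly poly \<Rightarrow> real \<Rightarrow> bool" where
  "regular_at f x \<longleftrightarrow> poly (lead_coeff f) x \<noteq> 0 \<and> (\<forall>y. poly2 f x y = 0 \<longrightarrow> poly2 (pderiv f) x y \<noteq> 0)"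

lemma finite_roots: "spec f x \<noteq> 0 \<Longrightarrow> finite (roots f x)"
  using poly_roots_finite[of "spec f x"] by (simp add: roots_def poly_spec)

lemma card_roots_le: "spec f x \<noteq> 0 \<Longrightarrow> card (roots f x) \<le> degree f"
  unfolding roots_def poly_spec[symmetric] spec_def
  using card_poly_roots_bound map_poly_degree_leq order_trans by blast

lemma spec_nonzero: "poly (lead_coeff f) x \<noteq> 0 \<Longrightarrow> spec f x \<noteq> 0"
  unfolding spec_def poly_eq_iff by (auto simp: Polynomial.coeff_map_poly intro!: exI[of _ "degree f"])

lemma regular_atD:
  assumes "regular_at f x"
  shows "finite (roots f x)" "poly (lead_coeff f) x \<noteq> 0"
    and "\<And>y. y \<in> roots f x \<Longrightarrow> poly2 (pderiv f) x y \<noteq> 0"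
  using assms finite_roots spec_nonzero by (auto simp: regular_at_def roots_def)

section \<open>Local constancy of the number of real roots and continuity of the roots\<close>

lemma poly2_pos_near:
  assumes "poly2 f x0 y0 > 0"
  obtains \<delta> where "\<delta> > 0" "\<And>x y. \<bar>x - x0\<bar> < \<delta> \<Longrightarrow> \<bar>y - y0\<bar> < \<delta> \<Longrightarrow> poly2 f x y > 0"
proof -
  have "((\<lambda>p. poly2 f (fst p) (snd p)) \<longlongrightarrow> poly2 f (fst (x0, y0)) (snd (x0, y0))) (nhds (x0, y0))"
    by (intro tendsto_intros filterlim_ident)
  then have "\<forall>\<^sub>F p in nhds (x0, y0). poly2 f (fst p) (snd p) > 0"
    using assms by (intro order_tendstoD) auto
  then obtain d where d: "d > 0" "\<And>p. dist p (x0, y0) < d \<Longrightarrow> poly2 f (fst p) (snd p) > 0"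
    by (auto simp: eventually_nhds_metric)
  show thesis
  proof (rule that[of "d / 2"])
    fix x y assume "\<bar>x - x0\<bar> < d / 2" "\<bar>y - y0\<bar> < d / 2"
    then have "dist (x, y) (x0, y0) < d"
      using sqrt_sum_squares_le_sum_abs[of "x - x0" "y - y0"] by (simp add: dist_Pair_Pair dist_real_def)
    from d(2)[OF this] show "poly2 f x y > 0" by simp
  qed (use d in simp)
qed

text \<open>In a small box \<open>f\<close> is strictly increasing in \<open>y\<close>, so there is
  at most one root; the sign change between \<open>y0 - e\<close> and \<open>y0 + e\<close> persists
  for nearby \<open>x\<close>, so there is one. Stating this for all small \<open>\<epsilon>\<close>
  lets finitely many roots share one \<open>\<epsilon>\<close>.\<close>

lemma unique_root_near_pos:
  assumes "poly2 f x0 y0 = 0" "poly2 (pderiv f) x0 y0 > 0"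
  shows "\<forall>\<^sub>F \<epsilon> in at_right 0. \<forall>\<^sub>F x in nhds x0. \<exists>!y. \<bar>y - y0\<bar> < \<epsilon> \<and> poly2 f x y = 0"
proof -
  obtain \<delta> where \<delta>: "\<delta> > 0" "\<And>x y. \<bar>x - x0\<bar> < \<delta> \<Longrightarrow> \<bar>y - y0\<bar> < \<delta> \<Longrightarrow> poly2 (pderiv f) x y > 0"
    using poly2_pos_near[OF assms(2)] by blast
  have mono: "poly2 f x a < poly2 f x b"
    if "\<bar>x - x0\<bar> < \<delta>" "a < b" "\<bar>a - y0\<bar> < \<delta>" "\<bar>b - y0\<bar> < \<delta>" for x a b
  proof (rule DERIV_pos_imp_increasing[OF \<open>a < b\<close>])
    fix y assume "a \<le> y" "y \<le> b"
    then have "\<bar>y - y0\<bar> < \<delta>" using that by linarith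
    then show "\<exists>z. ((\<lambda>y. poly2 f x y) has_real_derivative z) (at y) \<and> z > 0"
      using DERIV_poly2_snd \<delta>(2) that(1) by blast
  qed
  have "\<forall>\<^sub>F x in nhds x0. \<exists>!y. \<bar>y - y0\<bar> < \<epsilon> \<and> poly2 f x y = 0" if \<epsilon>: "0 < \<epsilon>" "\<epsilon> < \<delta>" for \<epsilon>
  proof -
    \<comment> \<open>The intermediate value theorem gives a root in a closed interval; halving puts
      it strictly within \<open>\<epsilon>\<close> of \<open>y0\<close>.\<close>
    define e where "e = \<epsilon> / 2"
    have e: "0 < e" "e < \<epsilon>" using \<epsilon> by (auto simp: e_def)
    have "poly2 f x0 (y0 - e) < 0" "0 < poly2 f x0 (y0 + e)"
      using mono[of x0 "y0 - e" y0] mono[of x0 y0 "y0 + e"] assms(1) e \<epsilon> \<delta>(1) by auto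
    moreover have "((\<lambda>x. poly2 f x y) \<longlongrightarrow> poly2 f x0 y) (nhds x0)" for y
      by (intro tendsto_intros filterlim_ident)
    ultimately have "\<forall>\<^sub>F x in nhds x0. poly2 f x (y0 - e) < 0" "\<forall>\<^sub>F x in nhds x0. 0 < poly2 f x (y0 + e)"
      using order_tendstoD by blast+
    moreover have "\<forall>\<^sub>F x in nhds x0. \<bar>x - x0\<bar> < \<delta>"
      using \<delta>(1) by (auto simp: eventually_nhds_metric dist_real_def)
    ultimately show ?thesis
    proof eventually_elim
      case (elim x)
      have "\<exists>y\<ge>y0 - e. y \<le> y0 + e \<and> poly2 f x y = 0"
        using elim e by (intro IVT') (auto intro!: continuous_intros)
      then obtain y where y: "y0 - e \<le> y" "y \<le> y0 + e" "poly2 f x y = 0" by blast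
      then have "\<bar>y - y0\<bar> < \<epsilon>" using e by linarith
      moreover note y(3)
      moreover have "y' = y''" if "\<bar>y' - y0\<bar> < \<epsilon>" "poly2 f x y' = 0" "\<bar>y'' - y0\<bar> < \<epsilon>" "poly2 f x y'' = 0" for y' y''
        using mono[of x y' y''] mono[of x y'' y'] elim(3) that \<epsilon> by (cases y' y'' rule: linorder_cases) auto
      ultimately show ?case by blast
    qed
  qed
  then show ?thesis using \<delta>(1) by (auto simp: eventually_at_right_field)
qed

lemma unique_root_near:
  assumes "poly2 f x0 y0 = 0" "poly2 (pderiv f) x0 y0 \<noteq> 0"
  shows "\<forall>\<^sub>F \<epsilon> in at_right 0. \<forall>\<^sub>F x in nhds x0. \<exists>!y. \<bar>y - y0\<bar> < \<epsilon> \<and> poly2 f x y = 0"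
  using unique_root_near_pos[of f x0 y0] unique_root_near_pos[of "- f" x0 y0] assms
  by (cases "poly2 (pderiv f) x0 y0 > 0") (auto simp: pderiv_minus)

text \<open>A root \<open>y\<close> of large modulus is a root \<open>1 / y\<close> near 0 of the
  reflected polynomial, whose value at \<open>y = 0\<close> is the leading coefficient and hence
  nonzero near \<open>x0\<close>.\<close>

lemma roots_bounded_near:
  assumes "poly (lead_coeff f) x0 \<noteq> 0"
  obtains L where "\<forall>\<^sub>F x in nhds x0. \<forall>y\<in>roots f x. \<bar>y\<bar> \<le> L"
proof -
  have lc: "\<forall>\<^sub>F x in nhds x0. poly (lead_coeff f) x \<noteq> 0"
    using assms by (intro tendsto_imp_eventually_ne[of _ "poly (lead_coeff f) x0"] tendsto_intros filterlim_ident)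
  \<comment> \<open>Squaring turns nonvanishing into positivity, the form of
    \<open>poly2_pos_near\<close>.\<close>
  define G where "G = reflect_poly f * reflect_poly f"
  have "poly2 (reflect_poly f) x0 0 = poly (lead_coeff f) x0"
    by (simp add: poly2_def)
  then have "poly2 G x0 0 > 0" using assms by (auto simp: G_def zero_less_mult_iff)
  from poly2_pos_near[OF this] obtain \<delta> where
    \<delta>: "\<delta> > 0" "\<And>x y. \<bar>x - x0\<bar> < \<delta> \<Longrightarrow> \<bar>y\<bar> < \<delta> \<Longrightarrow> poly2 G x y > 0" by auto
  have "\<forall>\<^sub>F x in nhds x0. \<bar>x - x0\<bar> < \<delta>"
    using \<delta>(1) by (auto simp: eventually_nhds_metric dist_real_def)
  with lc have "\<forall>\<^sub>F x in nhds x0. \<forall>y\<in>roots f x. \<bar>y\<bar> \<le> 1 / \<delta>"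
  proof eventually_elim
    case (elim x)
    have spec: "spec (reflect_poly f) x = reflect_poly (spec f x)"
      using degree_spec[OF elim(1)]
      by (intro poly_eqI) (auto simp: coeff_reflect_poly spec_def Polynomial.coeff_map_poly)
    show ?case
    proof (rule ballI, rule ccontr)
      fix y assume y: "y \<in> roots f x" "\<not> \<bar>y\<bar> \<le> 1 / \<delta>"
      then have y_gt: "\<bar>y\<bar> > 1 / \<delta>" by simp
      moreover have "1 / \<delta> > 0" using \<delta>(1) by simp
      ultimately have "\<bar>y\<bar> > 0" by linarith
      then have "y \<noteq> 0" "\<bar>inverse y\<bar> < \<delta>"
        using y_gt \<delta>(1) by (auto simp: field_simps)
      then have "poly2 (reflect_poly f) x (inverse y) \<noteq> 0"
        using \<delta>(2)[OF elim(2), of "inverse y"] by (auto simp: G_def)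
      then show False
        using poly_reflect_poly_nz[of "inverse y" "spec f x"] y \<open>y \<noteq> 0\<close>
        by (simp add: poly_spec flip: spec) (simp add: roots_def)
    qed
  qed
  then show thesis by (rule that)
qed

text \<open>Roots stay in a compact interval by \<open>roots_bounded_near\<close>. Removing the open
  balls around the roots over \<open>x0\<close> leaves a compact set without zeros over
  \<open>x0\<close>, and by the tube lemma without zeros over nearby \<open>x\<close>.\<close>

lemma roots_near:
  assumes "poly (lead_coeff f) x0 \<noteq> 0" "\<epsilon> > 0"
  shows "\<forall>\<^sub>F x in nhds x0. \<forall>y\<in>roots f x. \<exists>z\<in>roots f x0. \<bar>y - z\<bar> < \<epsilon>"
proof -
  obtain L where L: "\<forall>\<^sub>F x in nhds x0. \<forall>y\<in>roots f x. \<bar>y\<bar> \<le> L"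
    using roots_bounded_near[OF assms(1)] .
  define K where "K = {-L..L} - (\<Union>z\<in>roots f x0. ball z \<epsilon>)"
  define W where "W = {p. poly2 f (fst p) (snd p) \<noteq> 0}"
  have "compact K" unfolding K_def by (intro compact_diff) auto
  moreover have "open W" unfolding W_def by (intro open_Collect_neq continuous_intros)
  moreover have "{x0} \<times> K \<subseteq> W"
    using assms(2) by (force simp: K_def W_def roots_def)
  ultimately have "\<exists>X0. x0 \<in> X0 \<and> open X0 \<and> X0 \<times> K \<subseteq> W" by (rule Elementary_Topology.tube_lemma)
  then obtain X0 where X0: "x0 \<in> X0" "open X0" "X0 \<times> K \<subseteq> W" by blast
  have "\<forall>\<^sub>F x in nhds x0. x \<in> X0" using X0 by (simp add: eventually_nhds_in_open)
  with L show ?thesis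
  proof eventually_elim
    case (elim x)
    show ?case
    proof
      fix y assume y: "y \<in> roots f x"
      then have "(x, y) \<notin> W" by (simp add: W_def roots_def)
      then have "y \<notin> K" using X0(3) elim(2) by blast
      moreover have "\<bar>y\<bar> \<le> L" using elim(1) y by blast
      ultimately show "\<exists>z\<in>roots f x0. \<bar>y - z\<bar> < \<epsilon>"
        by (auto simp: K_def dist_real_def abs_minus_commute)
    qed
  qed
qed

text \<open>Sending \<open>z\<close> to the unique element of \<open>R\<close> near it is a
  bijection, and the separation makes it increasing; hence it maps one sorted list onto the other,
  entry by entry.\<close>

lemma sorted_list_of_set_nth_close:
  fixes R R0 :: "real set"
  assumes "finite R0"
    and sep: "\<And>z z'. z \<in> R0 \<Longrightarrow> z' \<in> R0 \<Longrightarrow> z < z' \<Longrightarrow> 2 * \<epsilon> < z' - z"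
    and ex1: "\<And>z. z \<in> R0 \<Longrightarrow> \<exists>!y. \<bar>y - z\<bar> < \<epsilon> \<and> y \<in> R"
    and near: "\<And>y. y \<in> R \<Longrightarrow> \<exists>z\<in>R0. \<bar>y - z\<bar> < \<epsilon>"
  shows "card R = card R0"
    and "k < card R0 \<Longrightarrow> \<bar>sorted_list_of_set R ! k - sorted_list_of_set R0 ! k\<bar> < \<epsilon>"
proof -
  obtain \<phi> where \<phi>: "\<And>z. z \<in> R0 \<Longrightarrow> \<bar>\<phi> z - z\<bar> < \<epsilon> \<and> \<phi> z \<in> R" using ex1 by metis
  have mono: "\<phi> z < \<phi> z'" if "z \<in> R0" "z' \<in> R0" "z < z'" for z z'
    using \<phi>[OF that(1)] \<phi>[OF that(2)] sep[OF that] by linarith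
  have "\<phi> ` R0 = R"
  proof safe
    fix y assume "y \<in> R"
    then obtain z where "z \<in> R0" "\<bar>y - z\<bar> < \<epsilon>" using near by blast
    then have "y = \<phi> z" using ex1 \<phi> \<open>y \<in> R\<close> by blast
    then show "y \<in> \<phi> ` R0" using \<open>z \<in> R0\<close> by blast
  qed (use \<phi> in auto)
  have "inj_on \<phi> R0" by (rule linorder_inj_onI) (use mono in force)+
  then show card: "card R = card R0" using \<open>\<phi> ` R0 = R\<close> card_image by blast
  have "finite R" using \<open>\<phi> ` R0 = R\<close> \<open>finite R0\<close> by blast
  have "sorted_wrt (<) (map \<phi> (sorted_list_of_set R0))"
    using \<open>finite R0\<close> unfolding sorted_wrt_map
    by (intro sorted_wrt_mono_rel[OF _ strict_sorted_list_of_set]) (use mono in auto)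
  moreover have "set (map \<phi> (sorted_list_of_set R0)) = R"
    using \<open>finite R0\<close> \<open>\<phi> ` R0 = R\<close> by simp
  ultimately have eq: "map \<phi> (sorted_list_of_set R0) = sorted_list_of_set R"
    using \<open>finite R\<close> by (intro strict_sorted_equal) auto
  assume "k < card R0"
  then have "k < length (sorted_list_of_set R0)" by simp
  moreover from this have "sorted_list_of_set R0 ! k \<in> R0"
    using \<open>finite R0\<close> nth_mem set_sorted_list_of_set by metis
  ultimately show "\<bar>sorted_list_of_set R ! k - sorted_list_of_set R0 ! k\<bar> < \<epsilon>"
    using \<phi> by (simp flip: eq)
qed

lemma finite_separated:
  fixes R :: "real set"
  assumes "finite R"
  shows "\<forall>\<^sub>F \<epsilon> in at_right 0. \<forall>z\<in>R. \<forall>z'\<in>R. z < z' \<longrightarrow> 2 * \<epsilon> < z' - z"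
proof (intro eventually_ball_finite[OF assms] ballI)
  fix z z' :: real
  show "\<forall>\<^sub>F \<epsilon> in at_right 0. z < z' \<longrightarrow> 2 * \<epsilon> < z' - z"
    by (cases "z < z'") (auto simp: eventually_at_right_field intro!: exI[of _ "(z' - z) / 2"])
qed

text \<open>Simplicity gives exactly one new root near each old one, and \<open>roots_near\<close>
  leaves no others, so for small \<open>\<epsilon>\<close> the sorted lists of roots match.\<close>

lemma roots_locally_constant:
  assumes "regular_at f x0"
  shows "\<forall>\<^sub>F \<epsilon> in at_right 0. \<forall>\<^sub>F x in nhds x0. card (roots f x) = card (roots f x0) \<and>
    (\<forall>k<card (roots f x0). \<bar>nth_root f k x - nth_root f k x0\<bar> < \<epsilon>)"
proof -
  note reg = regular_atD[OF assms]
  have "\<forall>\<^sub>F \<epsilon> in at_right 0. \<forall>z\<in>roots f x0. \<forall>\<^sub>F x in nhds x0. \<exists>!y. \<bar>y - z\<bar> < \<epsilon> \<and> y \<in> roots f x"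
    using reg(3) unique_root_near by (intro eventually_ball_finite[OF reg(1)]) (auto simp: roots_def)
  moreover have "\<forall>\<^sub>F \<epsilon>::real in at_right 0. \<epsilon> > 0" by (rule eventually_at_right_less)
  ultimately show ?thesis using finite_separated[OF reg(1)]
  proof eventually_elim
    case (elim \<epsilon>)
    have "\<forall>\<^sub>F x in nhds x0. \<forall>z\<in>roots f x0. \<exists>!y. \<bar>y - z\<bar> < \<epsilon> \<and> y \<in> roots f x"
      by (rule eventually_ball_finite[OF reg(1) elim(1)])
    then show ?case using roots_near[OF reg(2) elim(2)]
    proof eventually_elim
      case (elim x)
      then show ?case
        using sorted_list_of_set_nth_close[OF reg(1), of \<epsilon> "roots f x"] \<open>\<forall>z\<in>roots f x0. \<forall>z'\<in>roots f x0. _ z z'\<close>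
        unfolding nth_root_def by blast
    qed
  qed
qed

lemma card_roots_locally_constant:
  assumes "regular_at f x0"
  shows "\<forall>\<^sub>F x in nhds x0. card (roots f x) = card (roots f x0)"
proof -
  obtain \<epsilon> where "\<forall>\<^sub>F x in nhds x0. card (roots f x) = card (roots f x0) \<and>
    (\<forall>k<card (roots f x0). \<bar>nth_root f k x - nth_root f k x0\<bar> < \<epsilon>)"
    using eventually_happens'[OF _ roots_locally_constant[OF assms]] trivial_limit_at_right_real by blast
  then show ?thesis by (rule eventually_mono) simp
qed

lemma isCont_nth_root:
  assumes "regular_at f x0" "k < card (roots f x0)"
  shows "isCont (nth_root f k) x0"
proof -
  have "\<forall>\<^sub>F x in nhds x0. dist (nth_root f k x) (nth_root f k x0) < e" if "e > 0" for e
  proof -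
    have "\<forall>\<^sub>F \<epsilon>::real in at_right 0. \<epsilon> < e" using that by (auto simp: eventually_at_right_field)
    from eventually_happens'[OF _ eventually_conj[OF this roots_locally_constant[OF assms(1)]]]
    obtain \<epsilon> where "\<epsilon> < e" "\<forall>\<^sub>F x in nhds x0. card (roots f x) = card (roots f x0) \<and>
      (\<forall>k<card (roots f x0). \<bar>nth_root f k x - nth_root f k x0\<bar> < \<epsilon>)"
      using trivial_limit_at_right_real by blast
    then show ?thesis using assms(2)
      by (auto simp: dist_real_def elim!: eventually_mono intro: less_trans)
  qed
  then show ?thesis
    unfolding isCont_def tendsto_iff by (auto intro: eventually_at_filter[THEN iffD2] eventually_mono)
qed

section \<open>Convexity of the branches\<close>

text \<open>A Caratheodory form of the chain rule along a merely continuous \<open>Y\<close>; it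
  serves to prove that \<open>Y\<close> is differentiable, so \<open>Y'\<close> cannot occur in
  it.\<close>

lemma poly2_increment:
  assumes "isCont Y x0"
  shows "\<exists>p q. (\<forall>x. poly2 f x (Y x) - poly2 f x0 (Y x0) = (x - x0) * p x + (Y x - Y x0) * q x) \<and>
    p \<midarrow>x0\<rightarrow> poly2 (pderiv_x f) x0 (Y x0) \<and> q \<midarrow>x0\<rightarrow> poly2 (pderiv f) x0 (Y x0)"
proof (induction f)
  case 0
  show ?case by (intro exI[of _ "\<lambda>_. 0"]) simp
next
  case (pCons a f)
  then obtain p q where
    pq: "\<And>x. poly2 f x (Y x) - poly2 f x0 (Y x0) = (x - x0) * p x + (Y x - Y x0) * q x"
    and p: "p \<midarrow>x0\<rightarrow> poly2 (pderiv_x f) x0 (Y x0)" and q: "q \<midarrow>x0\<rightarrow> poly2 (pderiv f) x0 (Y x0)"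
    by blast
  obtain g where g: "\<And>x. poly a x - poly a x0 = g x * (x - x0)" "isCont g x0" "g x0 = poly (pderiv a) x0"
    using poly_DERIV[of a x0] unfolding CARAT_DERIV by blast
  have Y: "Y \<midarrow>x0\<rightarrow> Y x0" and g': "g \<midarrow>x0\<rightarrow> poly (pderiv a) x0" using assms g(2,3) by (auto simp: isCont_def)
  define p' where "p' x = g x + Y x0 * p x" for x
  define q' where "q' x = poly2 f x (Y x) + Y x0 * q x" for x
  have "poly2 (pCons a f) x (Y x) - poly2 (pCons a f) x0 (Y x0) = (x - x0) * p' x + (Y x - Y x0) * q' x" for x
  proof -
    \<comment> \<open>Telescoping for \<open>a + y * f\<close>: the increment of \<open>f\<close>
      appears only with the fixed factor \<open>Y x0\<close>, where the induction hypothesis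
      applies.\<close>
    have "poly2 (pCons a f) x (Y x) - poly2 (pCons a f) x0 (Y x0) = (poly a x - poly a x0)
      + (Y x - Y x0) * poly2 f x (Y x) + Y x0 * (poly2 f x (Y x) - poly2 f x0 (Y x0))"
      by (simp add: algebra_simps)
    then show ?thesis unfolding pq g(1) p'_def q'_def by (simp add: algebra_simps)
  qed
  moreover have "p' \<midarrow>x0\<rightarrow> poly2 (pderiv_x (pCons a f)) x0 (Y x0)"
    unfolding p'_def by (auto simp: Polynomial.map_poly_pCons intro!: tendsto_intros g' p)
  moreover have "q' \<midarrow>x0\<rightarrow> poly2 (pderiv (pCons a f)) x0 (Y x0)"
    unfolding q'_def by (auto simp: pderiv_pCons intro!: tendsto_intros Y q)
  ultimately show ?case by blast
qed

text \<open>On the curve the increment in \<open>poly2_increment\<close> is zero, which makes the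
  difference quotient of \<open>Y\<close> equal to \<open>- p x / q x\<close>.\<close>

lemma DERIV_implicit:
  assumes "isCont Y x0" "\<forall>\<^sub>F x in nhds x0. poly2 f x (Y x) = 0" "poly2 (pderiv f) x0 (Y x0) \<noteq> 0"
  shows "(Y has_real_derivative - poly2 (pderiv_x f) x0 (Y x0) / poly2 (pderiv f) x0 (Y x0)) (at x0)"
proof -
  obtain p q where
    pq: "\<And>x. poly2 f x (Y x) - poly2 f x0 (Y x0) = (x - x0) * p x + (Y x - Y x0) * q x"
    and lim: "p \<midarrow>x0\<rightarrow> poly2 (pderiv_x f) x0 (Y x0)" "q \<midarrow>x0\<rightarrow> poly2 (pderiv f) x0 (Y x0)"
    using poly2_increment[OF assms(1)] by blast
  have "\<forall>\<^sub>F x in at x0. q x \<noteq> 0" using tendsto_imp_eventually_ne[OF lim(2) assms(3)] .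
  moreover have f0: "poly2 f x0 (Y x0) = 0" and "\<forall>\<^sub>F x in at x0. poly2 f x (Y x) = 0"
    using assms(2) by (auto simp: eventually_nhds_conv_at)
  note this(2)
  moreover have "\<forall>\<^sub>F x in at x0. x \<noteq> x0" by (simp add: eventually_at_filter)
  ultimately have "\<forall>\<^sub>F x in at x0. (Y x - Y x0) / (x - x0) = - p x / q x"
  proof eventually_elim
    case (elim x)
    then have "(x - x0) * p x + (Y x - Y x0) * q x = 0" using pq[of x] f0 by simp
    then show ?case using elim by (simp add: field_simps)
  qed
  moreover have "((\<lambda>x. - p x / q x) \<longlongrightarrow> - poly2 (pderiv_x f) x0 (Y x0) / poly2 (pderiv f) x0 (Y x0)) (at x0)"
    using assms(3) by (intro tendsto_intros lim)
  ultimately show ?thesis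
    unfolding has_field_derivative_iff by (simp add: tendsto_cong)
qed

text \<open>Along a branch \<open>y = Y x\<close> of the curve one has \<open>Y'' = - hessian f / f\<^sub>y ^ 3\<close>; see
  \<open>DERIV_slope\<close>.\<close>

definition hessian :: "real poly poly \<Rightarrow> real poly poly" where
  "hessian f = pderiv_x (pderiv_x f) * (pderiv f * pderiv f)
    - pderiv (pderiv_x f) * (pderiv_x f * pderiv f)
    - pderiv_x (pderiv f) * (pderiv_x f * pderiv f)
    + pderiv (pderiv f) * (pderiv_x f * pderiv_x f)"

definition slope :: "real poly poly \<Rightarrow> real \<Rightarrow> real \<Rightarrow> real" where
  "slope f x y = - poly2 (pderiv_x f) x y / poly2 (pderiv f) x y"

text \<open>The second derivative of a branch, not its geometric curvature; only its sign
  matters.\<close>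

definition curvature :: "real poly poly \<Rightarrow> real \<Rightarrow> real \<Rightarrow> real" where
  "curvature f x y = - poly2 (hessian f) x y / poly2 (pderiv f) x y ^ 3"

lemma DERIV_slope:
  assumes "(Y has_real_derivative slope f x0 (Y x0)) (at x0)" "poly2 (pderiv f) x0 (Y x0) \<noteq> 0"
  shows "((\<lambda>x. slope f x (Y x)) has_real_derivative curvature f x0 (Y x0)) (at x0)"
proof -
  note D = DERIV_poly2[OF DERIV_ident assms(1)]
  \<comment> \<open>The quotient rule for \<open>- p / q\<close> with \<open>p\<close> and
    \<open>q\<close> the partial derivatives of \<open>f\<close>. \<open>A\<close> and
    \<open>E\<close> are the pure second derivatives, \<open>B\<close> and \<open>C\<close> the
    mixed ones in either order.\<close>
  have eq: "(- (A * 1 + B * (- p / q)) * q - - p * (C * 1 + E * (- p / q))) / (q * q)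
      = - (A * (q * q) - B * (p * q) - C * (p * q) + E * (p * p)) / q ^ 3"
    if "q \<noteq> 0" for A B C E p q :: real
    using that by (simp add: field_simps power3_eq_cube)
  show ?thesis
    using DERIV_divide[OF DERIV_minus[OF D[of "pderiv_x f"]] D[of "pderiv f"] assms(2)]
    unfolding slope_def curvature_def hessian_def poly2_simps eq[OF assms(2)] .
qed

section \<open>A single branch over a compact interval\<close>

lemma nth_root_in_roots:
  assumes "finite (roots f x)" "k < card (roots f x)"
  shows "poly2 f x (nth_root f k x) = 0"
proof -
  have "nth_root f k x \<in> set (sorted_list_of_set (roots f x))"
    unfolding nth_root_def by (rule nth_mem) (use assms in simp)
  then show ?thesis using assms(1) by (simp add: roots_def)
qed

text \<open>Regularity on an open neighbourhood \<open>U\<close> gives two-sided derivatives also at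
  \<open>u\<close> and \<open>v\<close>. The branch is assumed to exist at one point only;
  \<open>card_roots\<close> carries it along the interval, since a locally constant number is
  constant on a connected set.\<close>

locale regular_interval =
  fixes f :: "real poly poly" and U :: "real set" and k :: nat and u v x1 :: real
  assumes open_U: "open U" and uv: "{u..v} \<subseteq> U" and regular: "\<And>x. x \<in> U \<Longrightarrow> regular_at f x"
    and x1: "x1 \<in> {u..v}" "k < card (roots f x1)"
begin

lemma card_roots: "x \<in> {u..v} \<Longrightarrow> k < card (roots f x)"
proof -
  assume x: "x \<in> {u..v}"
  have "card (roots f x1) = card (roots f x)"
  proof (rule connected_local_const[of "{u..v}"])
    show "\<forall>a\<in>{u..v}. \<forall>\<^sub>F b in at a within {u..v}. card (roots f a) = card (roots f b)"
    proof
      fix a assume "a \<in> {u..v}"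
      then have "\<forall>\<^sub>F x in nhds a. card (roots f x) = card (roots f a)"
        using uv regular card_roots_locally_constant by blast
      then show "\<forall>\<^sub>F b in at a within {u..v}. card (roots f a) = card (roots f b)"
        unfolding eventually_at_filter by (rule eventually_mono) simp
    qed
  qed (use x1 x in auto)
  then show ?thesis using x1 by simp
qed

lemma deriv_nonzero: "x \<in> {u..v} \<Longrightarrow> poly2 (pderiv f) x (nth_root f k x) \<noteq> 0"
  using uv regular regular_atD[of f x] nth_root_in_roots[of f x k] card_roots[of x]
  by (auto simp: roots_def)

lemma DERIV_nth_root:
  assumes "x \<in> {u..v}"
  shows "(nth_root f k has_real_derivative slope f x (nth_root f k x)) (at x)"
  unfolding slope_def
proof (rule DERIV_implicit)
  have reg: "regular_at f x" using assms uv regular by blast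
  show "isCont (nth_root f k) x"
    using isCont_nth_root reg card_roots[OF assms] by blast
  have "\<forall>\<^sub>F x in nhds x. x \<in> U"
    using assms uv open_U by (intro eventually_nhds_in_open) auto
  then show "\<forall>\<^sub>F x in nhds x. poly2 f x (nth_root f k x) = 0"
    using card_roots_locally_constant[OF reg]
  proof eventually_elim
    case (elim x')
    then show ?case
      using nth_root_in_roots regular_atD(1)[OF regular] card_roots[OF assms] by simp
  qed
  show "poly2 (pderiv f) x (nth_root f k x) \<noteq> 0" by (rule deriv_nonzero[OF assms])
qed

lemma DERIV_slope_nth_root:
  assumes "x \<in> {u..v}"
  shows "((\<lambda>x. slope f x (nth_root f k x)) has_real_derivative curvature f x (nth_root f k x)) (at x)"
  by (intro DERIV_slope DERIV_nth_root deriv_nonzero assms)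

lemma curvature_sign:
  assumes "\<And>x. x \<in> {u..v} \<Longrightarrow> poly2 (hessian f) x (nth_root f k x) \<noteq> 0"
  obtains \<sigma> where "\<And>x. x \<in> {u..v} \<Longrightarrow> \<sigma> * curvature f x (nth_root f k x) > 0"
proof -
  define c where "c x = curvature f x (nth_root f k x)" for x
  have nz: "c x \<noteq> 0" if "x \<in> {u..v}" for x
    using assms[OF that] deriv_nonzero[OF that] by (simp add: c_def curvature_def)
  have "continuous_on {u..v} (nth_root f k)"
    using DERIV_nth_root DERIV_isCont by (blast intro: continuous_at_imp_continuous_on)
  then have "continuous_on {u..v} c"
    unfolding c_def curvature_def using deriv_nonzero by (auto intro!: continuous_intros)
  then have "connected (c ` {u..v})" by (rule connected_continuous_image) simp
  have same: "0 < c x1 * c x" if x: "x \<in> {u..v}" for x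
  proof (rule ccontr)
    assume "\<not> 0 < c x1 * c x"
    then have "c x1 \<le> 0 \<and> 0 \<le> c x \<or> c x \<le> 0 \<and> 0 \<le> c x1" by (auto simp: zero_less_mult_iff not_less)
    then have "0 \<in> c ` {u..v}"
      using \<open>connected (c ` {u..v})\<close> x x1(1) by (auto simp: connected_iff_interval)
    then show False using nz by auto
  qed
  \<comment> \<open>Any reference value of the nowhere vanishing continuous function
    \<open>c\<close> has the right sign.\<close>
  show thesis by (rule that[of "c x1"]) (use same in \<open>simp add: c_def\<close>)
qed

text \<open>Two mean values turn the slopes of the chords over \<open>[a, b]\<close> and
  \<open>[b, c]\<close> into derivatives at \<open>z1 < z2\<close>; a third turns their difference
  into a second derivative. The expression is \<open>orient\<close> of the three points of the
  graph.\<close>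

lemma nth_root_convex:
  assumes "\<And>x. x \<in> {u..v} \<Longrightarrow> \<sigma> * curvature f x (nth_root f k x) > 0"
    and abc: "u \<le> a" "a < b" "b < c" "c \<le> v"
  shows "\<sigma> * ((b - a) * (nth_root f k c - nth_root f k a) - (nth_root f k b - nth_root f k a) * (c - a)) > 0"
proof -
  define Y where "Y = nth_root f k"
  define s where "s x = slope f x (Y x)" for x
  have "\<exists>z>a. z < b \<and> Y b - Y a = (b - a) * s z"
    unfolding Y_def s_def using abc by (intro MVT2 DERIV_nth_root) auto
  then obtain z1 where z1: "a < z1" "z1 < b" "Y b - Y a = (b - a) * s z1" by blast
  have "\<exists>z>b. z < c \<and> Y c - Y b = (c - b) * s z"
    unfolding Y_def s_def using abc by (intro MVT2 DERIV_nth_root) auto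
  then obtain z2 where z2: "b < z2" "z2 < c" "Y c - Y b = (c - b) * s z2" by blast
  have "\<exists>z>z1. z < z2 \<and> s z2 - s z1 = (z2 - z1) * curvature f z (Y z)"
    unfolding Y_def s_def using abc z1 z2 by (intro MVT2 DERIV_slope_nth_root) auto
  then obtain z where z: "z1 < z" "z < z2" "s z2 - s z1 = (z2 - z1) * curvature f z (Y z)" by blast
  have "(b - a) * (Y c - Y a) - (Y b - Y a) * (c - a) = (b - a) * (Y c - Y b) - (Y b - Y a) * (c - b)"
    by (simp add: algebra_simps)
  also have "\<dots> = (b - a) * (c - b) * (s z2 - s z1)"
    unfolding z1(3) z2(3) by (simp add: algebra_simps)
  finally have eq: "(b - a) * (Y c - Y a) - (Y b - Y a) * (c - a) = (b - a) * (c - b) * (s z2 - s z1)" .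
  have "\<sigma> * ((b - a) * (Y c - Y a) - (Y b - Y a) * (c - a))
    = (b - a) * (c - b) * (z2 - z1) * (\<sigma> * curvature f z (Y z))"
    unfolding eq z(3) by (simp add: mult_ac)
  moreover have "(b - a) * (c - b) * (z2 - z1) > 0" using abc z1 z2 by simp
  moreover have "\<sigma> * curvature f z (Y z) > 0"
    using abc z1 z2 z assms(1)[of z] by (simp add: Y_def)
  ultimately have "\<sigma> * ((b - a) * (Y c - Y a) - (Y b - Y a) * (c - a)) > 0"
    by (simp only: mult_pos_pos)
  then show ?thesis by (simp add: Y_def)
qed

lemma nth_root_affine:
  assumes "\<And>x. x \<in> {u..v} \<Longrightarrow> poly2 (hessian f) x (nth_root f k x) = 0"
  obtains a b where "\<And>x. x \<in> {u..v} \<Longrightarrow> nth_root f k x = a + b * x"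
proof -
  have "\<exists>b. \<forall>x\<in>{u..v}. slope f x (nth_root f k x) = b"
  proof -
    have "slope f x (nth_root f k x) = slope f x1 (nth_root f k x1)" if "x \<in> {u..v}" for x
    proof (rule has_field_derivative_zero_constant[of "{u..v}", THEN exE])
      fix x assume "x \<in> {u..v}"
      then show "((\<lambda>x. slope f x (nth_root f k x)) has_field_derivative 0) (at x within {u..v})"
        using DERIV_slope_nth_root[of x] assms[of x]
        by (auto simp: curvature_def intro: has_field_derivative_at_within)
    qed (use that x1 in auto)
    then show ?thesis by blast
  qed
  then obtain b where b: "\<And>x. x \<in> {u..v} \<Longrightarrow> slope f x (nth_root f k x) = b" by blast
  have "\<exists>a. \<forall>x\<in>{u..v}. nth_root f k x - b * x = a"
  proof (rule has_field_derivative_zero_constant)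
    fix x assume "x \<in> {u..v}"
    then have "(nth_root f k has_real_derivative b) (at x within {u..v})"
      using DERIV_nth_root b by (auto intro: has_field_derivative_at_within)
    then show "((\<lambda>x. nth_root f k x - b * x) has_field_derivative 0) (at x within {u..v})"
      by (auto intro!: derivative_eq_intros)
  qed simp
  then obtain a where "\<And>x. x \<in> {u..v} \<Longrightarrow> nth_root f k x - b * x = a" by blast
  then have "nth_root f k x = a + b * x" if "x \<in> {u..v}" for x using that by fastforce
  then show thesis by (rule that)
qed

end

section \<open>Exceptional abscissae\<close>

lemma degree_of_nat_mult_le: "degree (of_nat n * p) \<le> degree (p :: 'a::comm_semiring_1 poly)"
  using degree_smult_le[of "of_nat n" p] by (simp add: of_nat_poly)

lemma coeffs_bounded_total_degree:
  assumes "total_degree f \<le> d"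
  shows "coeffs_bounded d f"
proof -
  note * = assms[unfolded total_degree_le_iff, rule_format]
  have "i \<le> d \<and> degree (coeff f i) \<le> d" if "coeff f i \<noteq> 0" for i
    using *[of i "degree (coeff f i)"] that by auto
  then have "\<forall>i. degree (coeff f i) \<le> d" "degree f \<le> d"
    by (metis degree_0 le0) (metis degree_0 le0 leading_coeff_0_iff \<open>\<And>i. coeff f i \<noteq> 0 \<Longrightarrow> _ i\<close>)
  then show ?thesis by (simp add: coeffs_bounded_def)
qed

lemma coeffs_bounded_add: "coeffs_bounded D f \<Longrightarrow> coeffs_bounded D g \<Longrightarrow> coeffs_bounded D (f + g)"
  by (simp add: coeffs_bounded_def degree_add_le)

lemma coeffs_bounded_diff: "coeffs_bounded D f \<Longrightarrow> coeffs_bounded D g \<Longrightarrow> coeffs_bounded D (f - g)"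
  by (simp add: coeffs_bounded_def degree_diff_le)

lemma coeffs_bounded_mult:
  assumes "coeffs_bounded D f" "coeffs_bounded E g"
  shows "coeffs_bounded (D + E) (f * g)"
proof -
  have "degree (coeff f i * coeff g j) \<le> D + E" for i j
    using degree_mult_le[of "coeff f i" "coeff g j"] assms
    by (meson add_mono coeffs_bounded_def order_trans)
  then have "degree (coeff (f * g) n) \<le> D + E" for n
    unfolding coeff_mult by (intro degree_sum_le) auto
  moreover have "degree (f * g) \<le> D + E"
    using degree_mult_le[of f g] assms by (meson add_mono coeffs_bounded_def order_trans)
  ultimately show ?thesis by (simp add: coeffs_bounded_def)
qed

lemma coeffs_bounded_pderiv:
  assumes "coeffs_bounded D f"
  shows "coeffs_bounded D (pderiv f)"
  unfolding coeffs_bounded_def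
proof (intro conjI allI)
  show "degree (pderiv f) \<le> D" using assms by (auto simp: coeffs_bounded_def degree_pderiv)
  show "degree (coeff (pderiv f) i) \<le> D" for i
    unfolding coeff_pderiv
    using degree_of_nat_mult_le[of "Suc i" "coeff f (Suc i)"] assms order_trans
    by (auto simp: coeffs_bounded_def simp del: of_nat_Suc)
qed

lemma coeffs_bounded_pderiv_x:
  assumes "coeffs_bounded D f"
  shows "coeffs_bounded D (pderiv_x f)"
  using assms map_poly_degree_leq[of pderiv f]
  by (auto simp: coeffs_bounded_def Polynomial.coeff_map_poly degree_pderiv intro: order_trans le_diff_conv[THEN iffD2] trans_le_add1)

lemma coeffs_bounded_hessian:
  assumes "coeffs_bounded D f"
  shows "coeffs_bounded (D + (D + D)) (hessian f)"
  unfolding hessian_def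
  by (intro coeffs_bounded_add coeffs_bounded_diff coeffs_bounded_mult coeffs_bounded_pderiv
      coeffs_bounded_pderiv_x assms)

section \<open>Curves that are lines\<close>

lemma irreducible_dvd_imp_subset_zeros:
  assumes "irreducible f" "L dvd f" "\<not> L dvd 1" "p \<in> real_points f"
  shows "poly2 L (p $ 1) (p $ 2) = 0"
proof -
  have "f dvd L" using assms(1-3) irreducibleD' by blast
  then obtain g where "L = f * g" by blast
  then show ?thesis using assms(4) by (simp add: real_points_def)
qed

lemma vec2_eq_iff: "p = q \<longleftrightarrow> p $ 1 = q $ 1 \<and> p $ 2 = q $ 2" for p q :: "real ^ 2"
  by (simp add: Finite_Cartesian_Product.vec_eq_iff forall_2)

text \<open>The divisor is the polynomial \<open>y - (a + b * x)\<close>, a nonunit; the irreducible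
  \<open>f\<close> therefore divides it, and the curve lies on that line.\<close>

lemma collinear_if_contains_graph:
  assumes "irreducible f" "[:- [:a, b:], 1:] dvd f"
  shows "collinear (real_points f)"
proof -
  have "p $ 2 = a + b * p $ 1" if "p \<in> real_points f" for p
    using irreducible_dvd_imp_subset_zeros[OF assms _ that] by (simp add: poly_dvd_1 is_unit_pCons_iff algebra_simps)
  then have "x - y = (x $ 1 - y $ 1) *\<^sub>R vector [1, b]" if "x \<in> real_points f" "y \<in> real_points f" for x y
    using that by (simp add: vec2_eq_iff algebra_simps)
  then show ?thesis unfolding collinear_def by blast
qed

text \<open>Here \<open>f\<close> involves only \<open>x\<close>. A real point gives it a linear
  factor in \<open>x\<close>, so the curve is a vertical line.\<close>

lemma collinear_if_degree_0:
  assumes "irreducible f" "degree f = 0"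
  shows "collinear (real_points f)"
proof (cases "real_points f = {}")
  case False
  then obtain p0 where p0: "p0 \<in> real_points f" by blast
  obtain c where f: "f = [:c:]" using assms(2) degree_eq_zeroE by blast
  have "poly c (p0 $ 1) = 0" using p0 by (simp add: f real_points_def)
  then have "[:- (p0 $ 1), 1:] dvd c" by (simp add: poly_eq_0_iff_dvd)
  then have "[:[:- (p0 $ 1), 1:]:] dvd f" by (simp add: f)
  then have "p $ 1 = p0 $ 1" if "p \<in> real_points f" for p
    using irreducible_dvd_imp_subset_zeros[OF assms(1) _ _ that, of "[:[:- (p0 $ 1), 1:]:]"]
    by (simp add: poly_dvd_1)
  then have "x - y = (x $ 2 - y $ 2) *\<^sub>R vector [0, 1]" if "x \<in> real_points f" "y \<in> real_points f" for x y
    using that by (simp add: vec2_eq_iff)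
  then show ?thesis unfolding collinear_def by blast
qed simp

text \<open>A curve containing the whole vertical line over \<open>x\<close> would, by
  irreducibility, be that line, and \<open>f\<close> would have degree 0 in
  \<open>y\<close>.\<close>

lemma spec_irreducible_nonzero:
  assumes "irreducible f" "degree f > 0"
  shows "spec f x \<noteq> 0"
proof
  assume "spec f x = 0"
  then have "poly (coeff f i) x = 0" for i
    using Polynomial.coeff_map_poly[of "\<lambda>c. poly c x" f i] by (simp add: spec_def)
  then have "[:[:- x, 1:]:] dvd f" by (simp add: const_poly_dvd_iff poly_eq_0_iff_dvd)
  moreover have "\<not> [:[:- x, 1:]:] dvd 1" by (simp add: poly_dvd_1)
  ultimately have "f dvd [:[:- x, 1:]:]" using irreducibleD' assms(1) by blast
  then have "degree f \<le> degree [:[:- x, 1:]:]" by (rule dvd_imp_degree_le) simp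
  then show False using assms(2) by simp
qed

text \<open>Eliminating \<open>y\<close> from \<open>f\<close> and its \<open>y\<close>-derivative,
  which \<open>f\<close> cannot divide for reasons of degree, gives the abscissae of multiple roots;
  the factor \<open>lead_coeff f\<close> adds the possible vertical asymptotes.\<close>

lemma regular_at_cofinite:
  assumes "irreducible f" "degree f > 0" "coeffs_bounded d f"
  obtains r where "r \<noteq> 0" "degree r \<le> d + (d + d + (d + d) * d)"
    "\<And>x. poly r x \<noteq> 0 \<Longrightarrow> regular_at f x"
proof -
  have "pderiv f \<noteq> 0" using assms(2) by (simp add: pderiv_eq_0_iff)
  moreover have "degree (pderiv f) < degree f" using assms(2) by (simp add: degree_pderiv)
  ultimately have "\<not> f dvd pderiv f" using dvd_imp_degree_le by fastforce
  from elimination[OF assms(1,2) this assms(3) coeffs_bounded_pderiv[OF assms(3)]]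
  obtain r where r: "r \<noteq> 0" "degree r \<le> d + d + (d + d) * d"
    "\<And>x y. poly2 f x y = 0 \<Longrightarrow> poly2 (pderiv f) x y = 0 \<Longrightarrow> poly r x = 0" by auto
  show thesis
  proof (rule that)
    show "lead_coeff f * r \<noteq> 0" using r(1) assms(2) by auto
    have "degree (lead_coeff f * r) \<le> degree (lead_coeff f) + degree r" by (rule degree_mult_le)
    also have "\<dots> \<le> d + (d + d + (d + d) * d)"
      using r(2) assms(3) by (intro add_mono) (auto simp: coeffs_bounded_def)
    finally show "degree (lead_coeff f * r) \<le> d + (d + d + (d + d) * d)" .
    show "regular_at f x" if "poly (lead_coeff f * r) x \<noteq> 0" for x
      using that r(3) by (auto simp: regular_at_def)
  qed
qed

lemma poly2_poly: "poly2 f x (poly p x) = poly (poly f p) x"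
  by (induction f) auto

lemma open_poly_nonzero: "open {x. poly r x \<noteq> (0::real)}"
  by (intro open_Collect_neq continuous_intros)

text \<open>If \<open>f\<close> divides its Hessian, every branch of the curve is affine, so the curve is a line.\<close>

lemma collinear_if_dvd_hessian:
  assumes "irreducible f" "f dvd hessian f"
    and reg: "\<And>x. poly r x \<noteq> 0 \<Longrightarrow> regular_at f x" and x0: "poly r x0 \<noteq> 0" "roots f x0 \<noteq> {}"
  shows "collinear (real_points f)"
proof -
  obtain e where e: "e > 0" "cball x0 e \<subseteq> {x. poly r x \<noteq> 0}"
    using open_contains_cball[THEN iffD1, OF open_poly_nonzero[of r]] x0 by blast
  have "card (roots f x0) > 0"
    using regular_atD(1)[OF reg[OF x0(1)]] x0(2) by (simp add: card_gt_0_iff)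
  then interpret regular_interval f "{x. poly r x \<noteq> 0}" 0 "x0 - e" "x0 + e" x0
    using e reg open_poly_nonzero by unfold_locales (auto simp: cball_eq_atLeastAtMost)
  have zero: "poly2 f x (nth_root f 0 x) = 0" if "x \<in> {x0 - e..x0 + e}" for x
    using nth_root_in_roots regular_atD(1)[OF regular] uv card_roots that by blast
  have "poly2 (hessian f) x (nth_root f 0 x) = 0" if "x \<in> {x0 - e..x0 + e}" for x
    using zero[OF that] assms(2) by (auto elim!: dvdE)
  then obtain a b where ab: "\<And>x. x \<in> {x0 - e..x0 + e} \<Longrightarrow> nth_root f 0 x = a + b * x"
    using nth_root_affine by blast
  \<comment> \<open>\<open>poly f [:a, b:]\<close> is the restriction of \<open>f\<close> to the
    line \<open>y = a + b * x\<close>. Vanishing on an interval, it is the zero polynomial, and this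
    is divisibility by \<open>y - (a + b * x)\<close>.\<close>
  have "poly (poly f [:a, b:]) x = 0" if "x \<in> {x0 - e..x0 + e}" for x
    using zero[OF that] ab[OF that] poly2_poly[of f x "[:a, b:]"] by (simp add: mult.commute)
  then have "{x0 - e..x0 + e} \<subseteq> {x. poly (poly f [:a, b:]) x = 0}" by blast
  moreover have "infinite {x0 - e..x0 + e}" using e(1) by simp
  ultimately have "poly f [:a, b:] = 0" using poly_roots_finite finite_subset by blast
  then have "[:- [:a, b:], 1:] dvd f" by (simp add: poly_eq_0_iff_dvd)
  then show ?thesis by (rule collinear_if_contains_graph[OF assms(1)])
qed

lemma card_on_vertical_lines_le:
  assumes "finite B" "finite A" "A \<subseteq> real_points f" "\<And>x. x \<in> B \<Longrightarrow> spec f x \<noteq> 0"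
  shows "card {p \<in> A. p $ 1 \<in> B} \<le> card B * degree f"
proof -
  have "card {p \<in> A. p $ 1 = x} \<le> degree f" if "x \<in> B" for x
  proof -
    have "card {p \<in> A. p $ 1 = x} \<le> card (roots f x)"
    proof (rule card_inj_on_le[where f = "\<lambda>p. p $ 2"])
      show "inj_on (\<lambda>p. p $ 2) {p \<in> A. p $ 1 = x}" by (auto simp: inj_on_def vec2_eq_iff)
      show "(\<lambda>p. p $ 2) ` {p \<in> A. p $ 1 = x} \<subseteq> roots f x"
        using assms(3) by (auto simp: real_points_def roots_def)
    qed (use finite_roots assms(4) that in blast)
    also have "\<dots> \<le> degree f" using card_roots_le assms(4) that by blast
    finally show ?thesis .
  qed
  moreover have "{p \<in> A. p $ 1 \<in> B} = (\<Union>x\<in>B. {p \<in> A. p $ 1 = x})" by auto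
  moreover have "card (\<Union>x\<in>B. {p \<in> A. p $ 1 = x}) \<le> (\<Sum>x\<in>B. card {p \<in> A. p $ 1 = x})"
    by (rule card_UN_le[OF assms(1)])
  ultimately show ?thesis
    using sum_bounded_above[of B "\<lambda>x. card {p \<in> A. p $ 1 = x}" "degree f"] by simp
qed

text \<open>Identifies the number of roots below a point, which serves as branch label, with the
  index in \<open>nth_root\<close>.\<close>

lemma sorted_list_of_set_nth_rank:
  fixes R :: "'a::linorder set"
  assumes "finite R" "y \<in> R"
  shows "card {z \<in> R. z < y} < card R" "sorted_list_of_set R ! card {z \<in> R. z < y} = y"
proof -
  define xs where "xs = sorted_list_of_set R"
  have xs: "set xs = R" "distinct xs" "sorted_wrt (<) xs" "length xs = card R"
    using assms(1) by (simp_all add: xs_def)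
  obtain j where j: "j < length xs" "xs ! j = y" using assms(2) xs(1) by (metis in_set_conv_nth)
  have "{z \<in> R. z < y} = (!) xs ` {..<j}"
  proof safe
    fix z assume "z \<in> R" "z < y"
    then obtain i where "i < length xs" "z = xs ! i" using xs(1) by (metis in_set_conv_nth)
    moreover have "i < j"
      using sorted_wrt_nth_less[OF xs(3), of j i] calculation \<open>z < y\<close> j
      by (metis linorder_neqE_nat order_less_asym)
    ultimately show "z \<in> (!) xs ` {..<j}" by blast
  next
    fix i assume "i < j"
    then show "xs ! i \<in> R" "xs ! i < y"
      using j xs(1) nth_mem[of i xs] sorted_wrt_nth_less[OF xs(3), of i j] by auto
  qed
  moreover have "inj_on ((!) xs) {..<j}"
    using j(1) xs(2) by (auto simp: inj_on_def nth_eq_iff_index_eq)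
  ultimately have "card {z \<in> R. z < y} = j" by (simp add: card_image)
  then show "card {z \<in> R. z < y} < card R" "sorted_list_of_set R ! card {z \<in> R. z < y} = y"
    using j xs(4) by (auto simp: xs_def)
qed

section \<open>Large convex chains on the curve\<close>

text \<open>The numbers \<open>m\<close> and \<open>k\<close> label the arcs into which the vertical lines over \<open>B\<close> cut the curve.\<close>

lemma same_arc_convex_chain:
  fixes A :: "(real ^ 2) set" and B :: "real set"
  assumes "finite A" "A \<subseteq> real_points f" "finite B" "A \<noteq> {}"
    and reg: "\<And>x. x \<notin> B \<Longrightarrow> regular_at f x"
    and hess: "\<And>x y. x \<notin> B \<Longrightarrow> poly2 f x y = 0 \<Longrightarrow> poly2 (hessian f) x y \<noteq> 0"
    and off: "\<And>p. p \<in> A \<Longrightarrow> p $ 1 \<notin> B"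
    and cell: "\<And>p. p \<in> A \<Longrightarrow> card {z \<in> B. z < p $ 1} = m"
    and rank: "\<And>p. p \<in> A \<Longrightarrow> card {y \<in> roots f (p $ 1). y < p $ 2} = k"
  obtains q :: "nat \<Rightarrow> real ^ 2" and \<sigma> :: real where
    "\<And>i. i < card A \<Longrightarrow> q i \<in> A"
    "\<And>i j. i < j \<Longrightarrow> j < card A \<Longrightarrow> q i $ 1 < q j $ 1"
    "\<And>i j k. i < j \<Longrightarrow> j < k \<Longrightarrow> k < card A \<Longrightarrow> \<sigma> * orient (q i) (q j) (q k) > 0"
proof -
  have root: "p $ 2 \<in> roots f (p $ 1)" if "p \<in> A" for p
    using assms(2) that by (auto simp: real_points_def roots_def)
  have snd: "k < card (roots f (p $ 1)) \<and> p $ 2 = nth_root f k (p $ 1)" if "p \<in> A" for p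
    using sorted_list_of_set_nth_rank[OF regular_atD(1)[OF reg[OF off[OF that]]] root[OF that]] rank[OF that]
    by (simp add: nth_root_def)
  define X where "X = (\<lambda>p. p $ 1) ` A"
  have inj: "inj_on (\<lambda>p. p $ 1) A"
    using snd by (auto simp: inj_on_def vec2_eq_iff)
  have X: "finite X" "X \<noteq> {}" "card X = card A"
    using assms(1,4) card_image[OF inj] by (simp_all add: X_def)
  define u v where "u = Min X" and "v = Max X"
  have uvX: "u \<in> X" "v \<in> X" "\<And>x. x \<in> X \<Longrightarrow> u \<le> x \<and> x \<le> v"
    using X by (simp_all add: u_def v_def)
  \<comment> \<open>An element of \<open>B\<close> between two abscissae would be counted for the
    right one but not for the left one, contrary to the common label \<open>m\<close>.\<close>
  have disj: "z \<notin> B" if "z \<in> {u..v}" for z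
  proof
    assume "z \<in> B"
    have "u \<notin> B" "v \<notin> B" using uvX off by (auto simp: X_def)
    then have "u < z" "z < v" using that \<open>z \<in> B\<close> by (auto simp: less_le)
    then have "{z \<in> B. z < u} \<subseteq> {z \<in> B. z < v}" "z \<in> {z \<in> B. z < v}" "z \<notin> {z \<in> B. z < u}"
      using \<open>z \<in> B\<close> by auto
    then have "{z \<in> B. z < u} \<subset> {z \<in> B. z < v}" by blast
    then have "card {z \<in> B. z < u} < card {z \<in> B. z < v}" using \<open>finite B\<close> by (intro psubset_card_mono) auto
    moreover have "card {z \<in> B. z < u} = m" "card {z \<in> B. z < v} = m"
      using uvX cell by (auto simp: X_def)
    ultimately show False by simp
  qed
  obtain p1 where p1: "p1 \<in> A" "p1 $ 1 = u" using uvX(1) by (auto simp: X_def)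
  interpret regular_interval f "- B" k u v u
  proof
    show "open (- B)" using \<open>finite B\<close> by (simp add: finite_imp_closed open_Compl)
    show "{u..v} \<subseteq> - B" using disj by blast
    show "u \<in> {u..v}" using uvX by auto
    show "k < card (roots f u)" using snd[OF p1(1)] p1(2) by simp
  qed (use reg in blast)
  have "poly2 (hessian f) x (nth_root f k x) \<noteq> 0" if x: "x \<in> {u..v}" for x
    using hess[OF disj[OF x]] nth_root_in_roots[OF _ card_roots[OF x]] regular_atD(1)[OF reg[OF disj[OF x]]]
    by blast
  then obtain \<sigma> where \<sigma>: "\<And>x. x \<in> {u..v} \<Longrightarrow> \<sigma> * curvature f x (nth_root f k x) > 0"
    using curvature_sign by blast
  define xs where "xs = sorted_list_of_set X"
  have xs: "set xs = X" "sorted_wrt (<) xs" "length xs = card A"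
    using X by (simp_all add: xs_def)
  \<comment> \<open>Since all points of \<open>A\<close> lie on branch \<open>k\<close>, the point
    of the graph over an abscissa in \<open>X\<close> is the point of \<open>A\<close>
    there.\<close>
  define q :: "nat \<Rightarrow> real ^ 2" where "q i = vector [xs ! i, nth_root f k (xs ! i)]" for i
  have q: "q i $ 1 = xs ! i" "q i $ 2 = nth_root f k (xs ! i)" for i by (simp_all add: q_def)
  have xs_less: "xs ! i < xs ! j" if "i < j" "j < card A" for i j
    using sorted_wrt_nth_less[OF xs(2), of i j] that xs(3) by simp
  have xs_in: "xs ! i \<in> X" if "i < card A" for i
    using nth_mem[of i xs] that xs by simp
  show thesis
  proof (rule that[of q \<sigma>])
    fix i assume "i < card A"
    then obtain p where p: "p \<in> A" "p $ 1 = xs ! i" using xs_in by (force simp: X_def)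
    then have "q i = p" using snd[OF p(1)] by (simp add: vec2_eq_iff q)
    then show "q i \<in> A" using p(1) by simp
  next
    fix i j assume "i < j" "j < card A"
    then show "q i $ 1 < q j $ 1" using xs_less by (simp add: q)
  next
    fix i j l assume ijl: "i < j" "j < l" "l < card A"
    then show "\<sigma> * orient (q i) (q j) (q l) > 0"
      unfolding orient_def q
      using uvX(3)[OF xs_in[of i]] uvX(3)[OF xs_in[of l]] by (intro nth_root_convex[OF \<sigma>] xs_less) auto
  qed
qed

text \<open>Pigeonhole on the labels of \<open>same_arc_convex_chain\<close>. They range over
  \<open>0..card B\<close> and \<open>0..degree f\<close>, whence the two summands 1.\<close>

lemma large_convex_chain:
  fixes A :: "(real ^ 2) set" and B :: "real set"
  assumes "finite A" "A \<subseteq> real_points f" "finite B" "A \<noteq> {}"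
    and reg: "\<And>x. x \<notin> B \<Longrightarrow> regular_at f x"
    and hess: "\<And>x y. x \<notin> B \<Longrightarrow> poly2 f x y = 0 \<Longrightarrow> poly2 (hessian f) x y \<noteq> 0"
    and off: "\<And>p. p \<in> A \<Longrightarrow> p $ 1 \<notin> B"
  obtains N and q :: "nat \<Rightarrow> real ^ 2" and \<sigma> :: real where
    "card A \<le> N * ((card B + 1) * (degree f + 1))"
    "\<And>i. i < N \<Longrightarrow> q i \<in> A"
    "\<And>i j. i < j \<Longrightarrow> j < N \<Longrightarrow> q i $ 1 < q j $ 1"
    "\<And>i j k. i < j \<Longrightarrow> j < k \<Longrightarrow> k < N \<Longrightarrow> \<sigma> * orient (q i) (q j) (q k) > 0"
proof -
  define c where "c p = (card {z \<in> B. z < p $ 1}, card {y \<in> roots f (p $ 1). y < p $ 2})" for p :: "real ^ 2"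
  have "card {y \<in> roots f (p $ 1). y < p $ 2} \<le> degree f" if "p \<in> A" for p
  proof -
    note r = regular_atD(1,2)[OF reg[OF off[OF that]]]
    have "card {y \<in> roots f (p $ 1). y < p $ 2} \<le> card (roots f (p $ 1))"
      using r(1) by (intro card_mono) auto
    also have "\<dots> \<le> degree f" by (rule card_roots_le[OF spec_nonzero[OF r(2)]])
    finally show ?thesis .
  qed
  moreover have "card {z \<in> B. z < x} \<le> card B" for x using \<open>finite B\<close> by (intro card_mono) auto
  ultimately have "c \<in> A \<rightarrow> {..card B} \<times> {..degree f}" by (auto simp: c_def)
  from pigeonhole_card[OF this \<open>finite A\<close>] obtain y where
    y: "card A \<le> card (c -` {y} \<inter> A) * card ({..card B} \<times> {..degree f})" by auto
  define T where "T = c -` {y} \<inter> A"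
  have T: "finite T" "T \<subseteq> A" "T \<noteq> {}"
    using y assms(1,4) by (auto simp: T_def card_eq_0_iff)
  have cell: "card {z \<in> B. z < p $ 1} = fst y" "card {y \<in> roots f (p $ 1). y < p $ 2} = snd y"
    if "p \<in> T" for p
    using that by (auto simp: T_def c_def)
  have sub: "T \<subseteq> real_points f" using T(2) assms(2) by (rule order_trans)
  have offT: "p $ 1 \<notin> B" if "p \<in> T" for p using off T(2) that by blast
  show thesis
  proof (rule same_arc_convex_chain[OF T(1) sub assms(3) T(3) reg hess offT cell])
    fix q :: "nat \<Rightarrow> real ^ 2" and \<sigma> :: real
    assume q: "\<And>i. i < card T \<Longrightarrow> q i \<in> T"
      "\<And>i j. i < j \<Longrightarrow> j < card T \<Longrightarrow> q i $ 1 < q j $ 1"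
      "\<And>i j k. i < j \<Longrightarrow> j < k \<Longrightarrow> k < card T \<Longrightarrow> \<sigma> * orient (q i) (q j) (q k) > 0"
    show thesis
    proof (rule that[OF _ _ q(2,3)])
      show "card A \<le> card T * ((card B + 1) * (degree f + 1))"
        using y by (simp add: T_def card_cartesian_product)
      show "\<And>i. i < card T \<Longrightarrow> q i \<in> A" using q(1) T(2) by blast
    qed
  qed
qed

section \<open>Final estimates and choice of constants\<close>

lemma card_poly_zeros_le: "r \<noteq> 0 \<Longrightarrow> finite {x. poly r x = (0::real)} \<and> card {x. poly r x = 0} \<le> degree r"
  using poly_roots_finite card_poly_roots_bound by blast

lemma exists_large_harm: "\<exists>N0. \<forall>N\<ge>N0. C < (harm (N div m) :: real)" if "m > 0"
proof -
  have "filterlim (\<lambda>n. ln (real n + 1)) at_top sequentially"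
    by (rule filterlim_compose[OF ln_at_top])
       (simp add: filterlim_tendsto_add_at_top[OF tendsto_const filterlim_real_sequentially] add.commute)
  then have "\<forall>\<^sub>F n in sequentially. C < ln (real n + 1)"
    by (simp add: filterlim_at_top_dense)
  then obtain n0 where n0: "\<And>n. n \<ge> n0 \<Longrightarrow> C < ln (real n + 1)"
    by (auto simp: eventually_sequentially)
  have "C < harm (N div m)" if "N \<ge> n0 * m" for N
  proof -
    have "n0 \<le> N div m" using that \<open>m > 0\<close> by (simp add: less_eq_div_iff_mult_less_eq)
    then show ?thesis using n0 ln_le_harm order_less_le_trans by blast
  qed
  then show ?thesis by blast
qed

text \<open>If \<open>f\<close> does not divide its Hessian, inflection points are eliminated as
  well and the two polynomials multiplied. If it does, a real point over a regular abscissa would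
  make the curve a line, so the Hessian condition holds vacuously.\<close>

lemma exceptional_abscissae:
  assumes "irreducible f" "degree f > 0" "coeffs_bounded d f" "\<not> collinear (real_points f)"
  shows "\<exists>r. r \<noteq> 0 \<and> degree r \<le> 100 * (d + d * d) \<and> (\<forall>x. poly r x \<noteq> 0 \<longrightarrow> regular_at f x \<and>
    (\<forall>y. poly2 f x y = 0 \<longrightarrow> poly2 (hessian f) x y \<noteq> 0))"
proof -
  obtain r1 where r1: "r1 \<noteq> 0" "degree r1 \<le> d + (d + d + (d + d) * d)"
    "\<And>x. poly r1 x \<noteq> 0 \<Longrightarrow> regular_at f x"
    using regular_at_cofinite[OF assms(1-3)] by blast
  show ?thesis
  proof (cases "f dvd hessian f")
    case True
    have "roots f x = {}" if "poly r1 x \<noteq> 0" for x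
      using collinear_if_dvd_hessian[OF assms(1) True r1(3) that] assms(4) by blast
    then show ?thesis using r1 by (intro exI[of _ r1]) (auto simp: roots_def algebra_simps)
  next
    case False
    define h where "h = d + (d + d)"
    obtain r2 where r2: "r2 \<noteq> 0" "degree r2 \<le> d + h + (d + h) * max d h"
      "\<And>x y. poly2 f x y = 0 \<Longrightarrow> poly2 (hessian f) x y = 0 \<Longrightarrow> poly r2 x = 0"
      using elimination[OF assms(1,2) False assms(3) coeffs_bounded_hessian[OF assms(3)]]
      unfolding h_def by blast
    have "degree (r1 * r2) \<le> degree r1 + degree r2" by (rule degree_mult_le)
    \<comment> \<open>The two degrees add up to at most \<open>7 * d + 14 * d * d\<close>; 100 is a
      generous round constant.\<close>
    also have "\<dots> \<le> 100 * (d + d * d)" using r1(2) r2(2) by (simp add: h_def max_def algebra_simps)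
    finally show ?thesis using r1 r2 by (intro exI[of _ "r1 * r2"]) auto
  qed
qed

theorem theorem9p1:
  shows "\<forall>d\<ge>1. \<forall>k\<ge>2. \<forall>l\<ge>2. \<exists>n0::nat.
    \<forall>(f :: real poly poly) (A :: (real ^ 2) set).
      irreducible f \<and> total_degree f \<le> d \<and> finite A \<and> A \<subseteq> real_points f \<and> card A \<ge> n0 \<longrightarrow>
        (\<exists>S\<subseteq>A. card S = k \<and> collinear S) \<or>
        (\<exists>S\<subseteq>A. card S = l \<and> mutually_visible A S)"
proof (intro allI impI)
  fix d k l :: nat assume "1 \<le> d" "2 \<le> k" "2 \<le> l"
  \<comment> \<open>\<open>b\<close> bounds the number of exceptional abscissae and \<open>M\<close>
    the number of arc labels.\<close>
  define b where "b = 100 * (d + d * d)"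
  define M where "M = (b + 1) * (d + 1)"
  \<comment> \<open>The set will satisfy \<open>card A \<le> 2 * N * M\<close>, so this is what
    \<open>convex_chain_visible\<close> demands after division by \<open>N\<close>.\<close>
  obtain N0 where N0: "\<And>N. N \<ge> N0 \<Longrightarrow> 4 * real l ^ 3 * real M < harm (N div (2 * l))"
    using exists_large_harm[of "2 * l" "4 * real l ^ 3 * real M"] \<open>2 \<le> l\<close> by auto
  \<comment> \<open>The summands serve in turn the case of a line, the at most \<open>b * d\<close>
    points on exceptional vertical lines, and a chain of more than \<open>N0\<close> points.\<close>
  define n0 where "n0 = k + 2 * b * d + 2 * M * (N0 + 1)"
  show "\<exists>n0::nat. \<forall>(f :: real poly poly) (A :: (real ^ 2) set).
      irreducible f \<and> total_degree f \<le> d \<and> finite A \<and> A \<subseteq> real_points f \<and> card A \<ge> n0 \<longrightarrow>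
        (\<exists>S\<subseteq>A. card S = k \<and> collinear S) \<or> (\<exists>S\<subseteq>A. card S = l \<and> mutually_visible A S)"
  proof (intro exI[of _ n0] allI impI; elim conjE)
    fix f :: "real poly poly" and A :: "(real ^ 2) set"
    assume f: "irreducible f" "total_degree f \<le> d" and A: "finite A" "A \<subseteq> real_points f" "n0 \<le> card A"
    show "(\<exists>S\<subseteq>A. card S = k \<and> collinear S) \<or> (\<exists>S\<subseteq>A. card S = l \<and> mutually_visible A S)"
    proof (cases "collinear (real_points f)")
      case True
      have "k \<le> card A" using A(3) by (simp add: n0_def)
      then obtain S where "S \<subseteq> A" "card S = k" by (rule obtain_subset_with_card_n)
      moreover from this have "S \<subseteq> real_points f" using A(2) by order
      then have "collinear S" by (rule collinear_subset[OF True])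
      ultimately show ?thesis by blast
    next
      case False
      have bound: "coeffs_bounded d f" by (rule coeffs_bounded_total_degree[OF f(2)])
      then have deg_le: "degree f \<le> d" by (simp add: coeffs_bounded_def)
      have deg: "degree f > 0" using collinear_if_degree_0[OF f(1)] False by blast
      obtain r where r: "r \<noteq> 0" "degree r \<le> b" "\<And>x. poly r x \<noteq> 0 \<Longrightarrow> regular_at f x"
        "\<And>x y. poly r x \<noteq> 0 \<Longrightarrow> poly2 f x y = 0 \<Longrightarrow> poly2 (hessian f) x y \<noteq> 0"
        using exceptional_abscissae[OF f(1) deg bound False] unfolding b_def by blast
      define B where "B = {x. poly r x = 0}"
      have B: "finite B" "card B \<le> b" using card_poly_zeros_le[OF r(1)] r(2) by (auto simp: B_def)
      define A' where "A' = {p \<in> A. p $ 1 \<notin> B}"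
      have "card {p \<in> A. p $ 1 \<in> B} \<le> card B * degree f"
        by (rule card_on_vertical_lines_le[OF B(1) A(1,2) spec_irreducible_nonzero[OF f(1) deg]])
      also have "\<dots> \<le> b * d" using B(2) deg_le by (rule mult_le_mono)
      finally have bad: "card {p \<in> A. p $ 1 \<in> B} \<le> b * d" .
      have "A = A' \<union> {p \<in> A. p $ 1 \<in> B}" by (auto simp: A'_def)
      then have "card A \<le> card A' + card {p \<in> A. p $ 1 \<in> B}" by (metis card_Un_le)
      with bad have A': "card A \<le> card A' + b * d" by linarith
      have large: "2 * (b * d) + 2 * (M * (N0 + 1)) \<le> card A" using A(3) by (simp add: n0_def algebra_simps)
      have "M > 0" by (simp add: M_def)
      then have "A' \<noteq> {}" using A' large by auto
      obtain N q \<sigma> where N: "card A' \<le> N * ((card B + 1) * (degree f + 1))"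
        and q: "\<And>i. i < N \<Longrightarrow> q i \<in> A'" "\<And>i j. i < j \<Longrightarrow> j < N \<Longrightarrow> q i $ 1 < q j $ 1"
          "\<And>i j k. i < j \<Longrightarrow> j < k \<Longrightarrow> k < N \<Longrightarrow> \<sigma> * orient (q i) (q j) (q k) > 0"
      proof (rule large_convex_chain[of A' f B])
        show "finite A'" "A' \<subseteq> real_points f" using A by (auto simp: A'_def)
      qed (use B(1) \<open>A' \<noteq> {}\<close> r in \<open>auto simp: B_def A'_def\<close>)
      have "N * ((card B + 1) * (degree f + 1)) \<le> N * M"
        unfolding M_def using B(2) deg_le by (intro mult_le_mono) auto
      with N have NM: "card A' \<le> N * M" by linarith
      have "M * (N0 + 1) \<le> M * N" using NM A' large unfolding mult.commute[of N M] by linarith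
      then have "N0 + 1 \<le> N" using \<open>M > 0\<close> unfolding mult_le_cancel1 by blast
      \<comment> \<open>The discarded points number at most \<open>b * d\<close>, hence at most half
        of \<open>A\<close>, so \<open>card A \<le> 2 * card A'\<close>.\<close>
      have "card A \<le> 2 * (N * M)" using NM A' large by linarith
      then have "real (card A) \<le> 2 * (real N * real M)" by (metis of_nat_le_iff of_nat_mult of_nat_numeral)
      then have "2 * real l ^ 3 * real (card A) \<le> 2 * real l ^ 3 * (2 * (real N * real M))"
        by (intro mult_left_mono) auto
      also have "\<dots> = real N * (4 * real l ^ 3 * real M)" by simp
      also have "\<dots> < real N * harm (N div (2 * l))"
        using N0[of N] \<open>N0 + 1 \<le> N\<close> by (intro mult_strict_left_mono) auto
      finally have large': "2 * real l ^ 3 * real (card A) < real N * harm (N div (2 * l))" .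
      have "l > 0" using \<open>2 \<le> l\<close> by simp
      have qA: "q i \<in> A" if "i < N" for i using q(1)[OF that] by (simp add: A'_def)
      have "\<exists>S\<subseteq>A. card S = l \<and> mutually_visible A S"
        by (rule convex_chain_visible[OF q(2,3) A(1) \<open>l > 0\<close> qA large'])
      then show ?thesis ..
    qed
  qed
qed

end
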